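(* Fix $D>0$. For $\varepsilon>0$ consider the thin rectangle $$\Omega_\varepsilon:=\left(-\frac{D}{2},\frac{D}{2}\right)\times(-\varepsilon,\varepsilon)\subset\mathbb{R}^2,$$ and let $\lambda^\varepsilon_1\le\lambda^\varepsilon_2$ denote the first two eigenvalues $\lambda$ (counted with multiplicity) of the problem $$-\Delta v(x) + \frac{1}{4}|x|^{2}v(x) = (\lambda+1)\, v(x),\quad x \in \Omega_\varepsilon, \qquad v(x) = 0,\quad x \in \partial \Omega_\varepsilon.$$ Then $$\lim_{\varepsilon\rightarrow0^+}(\lambda^\varepsilon_2-\lambda^\varepsilon_1)= \overline{\lambda}_2(D) - \overline{\lambda}_1(D),$$ where $\overline{\lambda}_1(D)$ and $\overline{\lambda}_2(D)$ are the first two Dirichlet eigenvalues of the operator $-\frac{d^2}{ds^2}+s\frac{d}{ds}$ on $(-\frac{D}{2},\frac{D}{2})$.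
   Context: The eigenvalues $\overline\lambda_1(D)<\overline\lambda_2(D)<\dots$ are the real numbers $\lambda$ for which $-u''(s)+su'(s)=\lambda u(s)$ on $(-D/2,D/2)$, $u(\pm D/2)=0$, has a nonzero solution. Via the gauge transformation $v(x)=u(x)e^{-|x|^2/4}$, the eigenvalue problem on $\Omega_\varepsilon$ is equivalent to the Dirichlet problem $\Delta u-\langle x,\nabla u\rangle=-\lambda u$ for the Ornstein-Uhlenbeck operator on $\Omega_\varepsilon$. *)

theory Defs
  imports "HOL-Analysis.Analysis" "HOL-Library.Extended_Nat" "HOL-Library.Function_Algebras"
begin

interpretation fun_vs: vector_space "\<lambda>(c::real) (f::'a \<Rightarrow> real) x. c * f x"
  by unfold_locales (auto simp: plus_fun_def algebra_simps)

definition partial :: "'a::euclidean_space \<Rightarrow> ('a \<Rightarrow> real) \<Rightarrow> 'a \<Rightarrow> real" where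
  "partial b f x = frechet_derivative f (at x) b"

text \<open>Meant for open \<open>S\<close>, where differentiability within \<open>S\<close> is differentiability.\<close>

definition C2_on :: "'a::euclidean_space set \<Rightarrow> ('a \<Rightarrow> real) \<Rightarrow> bool" where
  "C2_on S f \<longleftrightarrow> f differentiable_on S \<and>
     (\<forall>b\<in>Basis. partial b f differentiable_on S \<and>
        (\<forall>c\<in>Basis. continuous_on S (partial c (partial b f))))"

definition laplacian :: "('a::euclidean_space \<Rightarrow> real) \<Rightarrow> 'a \<Rightarrow> real" where
  "laplacian f x = (\<Sum>b\<in>Basis. partial b (partial b f) x)"

text \<open>
  Solutions, including the zero function, are classical: twice continuously differentiable in the
  open set and continuous up to the boundary. They are extended by zero outside the closure, so
  that equality and linear independence of functions on the whole plane mean equality and linear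
  independence on the closure. The plane is the product type, whose norm is Euclidean.
\<close>

definition eigenspace :: "(real \<times> real) set \<Rightarrow> real \<Rightarrow> (real \<times> real \<Rightarrow> real) set" where
  "eigenspace \<Omega> lam = {v. C2_on \<Omega> v \<and> continuous_on (closure \<Omega>) v \<and>
     (\<forall>x\<in>\<Omega>. - laplacian v x + 1 / 4 * (norm x)\<^sup>2 * v x = (lam + 1) * v x) \<and>
     (\<forall>x\<in>frontier \<Omega>. v x = 0) \<and> (\<forall>x. x \<notin> closure \<Omega> \<longrightarrow> v x = 0)}"

text \<open>The dimension of the eigenspace; zero exactly when \<open>lam\<close> is not an eigenvalue.\<close>

definition eig_multiplicity :: "(real \<times> real) set \<Rightarrow> real \<Rightarrow> enat" where
  "eig_multiplicity \<Omega> lam =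
     (SUP B\<in>{B. finite B \<and> B \<subseteq> eigenspace \<Omega> lam \<and> fun_vs.independent B}. enat (card B))"

text \<open>
  The \<open>k\<close>-th eigenvalue (counting from 1) is the least \<open>\<mu>\<close> such that the multiplicities of the
  eigenvalues up to \<open>\<mu>\<close> add up to at least \<open>k\<close>. The finite set \<open>F\<close> ranges over partial sums of
  that total, as \<open>sum\<close> over an infinite set would be zero.
\<close>

definition eigval :: "(real \<times> real) set \<Rightarrow> nat \<Rightarrow> real" where
  "eigval \<Omega> k = (LEAST \<mu>. \<exists>F. finite F \<and> F \<subseteq> {..\<mu>} \<and>
     enat k \<le> (\<Sum>lam\<in>F. eig_multiplicity \<Omega> lam))"

definition thin_rect :: "real \<Rightarrow> real \<Rightarrow> (real \<times> real) set" where
  "thin_rect D \<epsilon> = {-D/2<..<D/2} \<times> {-\<epsilon><..<\<epsilon>}"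

text \<open>Continuity of the second derivative is automatic from the equation.\<close>

definition OU_eigenvalue :: "real \<Rightarrow> real \<Rightarrow> bool" where
  "OU_eigenvalue D lam \<longleftrightarrow> (\<exists>u u' u''. continuous_on {-D/2..D/2} u \<and>
     (\<forall>s\<in>{-D/2<..<D/2}. (u has_real_derivative u' s) (at s) \<and>
        (u' has_real_derivative u'' s) (at s) \<and> - u'' s + s * u' s = lam * u s) \<and>
     u (-D/2) = 0 \<and> u (D/2) = 0 \<and> (\<exists>s\<in>{-D/2<..<D/2}. u s \<noteq> 0))"

text \<open>The \<open>k\<close>-th element (counting from 1) of the strictly increasing enumeration.\<close>

definition OU_eigval :: "real \<Rightarrow> nat \<Rightarrow> real" where
  "OU_eigval D k = (LEAST \<mu>. \<exists>F. finite F \<and> F \<subseteq> {lam. OU_eigenvalue D lam} \<inter> {..\<mu>} \<and> card F = k)"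

end

theory Submission
  imports Defs
begin

text \<open>
  The equation separates: with \<open>\<mu>\<^sub>1 < \<mu>\<^sub>2\<close> and \<open>\<nu>\<^sub>1 < \<nu>\<^sub>2\<close> the first two Dirichlet levels of
  \<open>- d\<^sup>2/ds\<^sup>2 + s\<^sup>2/4\<close> on \<open>(-D/2, D/2)\<close> and on \<open>(-\<epsilon>, \<epsilon>)\<close>, the first eigenvalue on the rectangle is
  \<open>\<mu>\<^sub>1 + \<nu>\<^sub>1 - 1\<close>, and the second is \<open>\<mu>\<^sub>2 + \<nu>\<^sub>1 - 1\<close> as soon as \<open>\<mu>\<^sub>2 - \<mu>\<^sub>1 \<le> \<nu>\<^sub>2 - \<nu>\<^sub>1\<close>. Since \<open>\<nu>\<^sub>2 - \<nu>\<^sub>1\<close>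
  tends to infinity as \<open>\<epsilon>\<close> tends to \<open>0\<close>, the gap is eventually equal to \<open>\<mu>\<^sub>2 - \<mu>\<^sub>1\<close>; and the gauge factor
  \<open>exp (- s\<^sup>2/4)\<close> shows that the Ornstein-Uhlenbeck eigenvalues are \<open>\<mu>\<^sub>i - 1/2\<close>.

  That there are no further eigenfunctions below \<open>\<mu>\<^sub>2 + \<nu>\<^sub>1 - 1\<close> needs neither completeness nor energy
  estimates. Let \<open>\<phi>\<close> be the first eigenfunction in \<open>x\<close> and \<open>P(x, y)\<close> the integral of \<open>v(t, y) \<phi>(t)\<close>
  over \<open>-D/2 \<le> t \<le> x\<close>. The full moment \<open>P(D/2, y)\<close> solves the one-dimensional Dirichlet problem in \<open>y\<close>,
  so it vanishes or is a multiple of the first eigenfunction on \<open>(-\<epsilon>, \<epsilon>)\<close>. If it vanishes, then \<open>P\<close> is zero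
  on the boundary and solves an elliptic equation (a Darboux transform in \<open>x\<close>) whose first level
  is \<open>\<mu>\<^sub>2 + \<nu>\<^sub>1\<close>, so \<open>P = 0\<close> by the maximum principle and \<open>v = 0\<close>.
\<close>

section \<open>Solutions of the oscillator equation\<close>

text \<open>Taylor coefficients at \<open>0\<close> of the solution of Hermite's equation
  \<open>u'' - s u' + lam u = 0\<close> with \<open>u(0) = c\<close> and
  \<open>u'(0) = d\<close>.\<close>

fun hcoeff :: "real \<Rightarrow> real \<Rightarrow> real \<Rightarrow> nat \<Rightarrow> real" where
  "hcoeff c d lam 0 = c"
| "hcoeff c d lam (Suc 0) = d"
| "hcoeff c d lam (Suc (Suc n)) = (real n - lam) / ((real n + 1) * (real n + 2)) * hcoeff c d lam n"

text \<open>One application of the recursion raises the index by two and multiplies by at most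
  \<open>K\<^sup>2 / sqrt ((n + 1) (n + 2))\<close>, which is exactly the growth of
  \<open>K ^ n / sqrt (fact n)\<close> over two indices. Hence the series is entire, with a majorant
  uniform for \<open>lam\<close> in a bounded set.\<close>

lemma hcoeff_bound:
  assumes "1 \<le> K" "\<bar>lam\<bar> + 1 \<le> K\<^sup>2" "\<bar>c\<bar> \<le> 1" "\<bar>d\<bar> \<le> 1"
  shows "\<bar>hcoeff c d lam n\<bar> \<le> K ^ n / sqrt (fact n)"
proof (induction n rule: induct_nat_012)
  case (ge2 n)
  have "real n + \<bar>lam\<bar> \<le> (\<bar>lam\<bar> + 1) * (real n + 1)"
    by (simp add: algebra_simps)
  also have "\<dots> \<le> K\<^sup>2 * (real n + 1)" 
    using assms(2) by (intro mult_right_mono) auto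
  also have "real n + 1 = sqrt ((real n + 1) * (real n + 1))" by simp
  also have "K\<^sup>2 * \<dots> \<le> K\<^sup>2 * sqrt ((real n + 1) * (real n + 2))"
    by (intro mult_left_mono real_sqrt_le_mono) auto
  finally have *: "real n + \<bar>lam\<bar> \<le> K\<^sup>2 * sqrt ((real n + 1) * (real n + 2))" .
  define q where "q = sqrt ((real n + 1) * (real n + 2))"
  have q: "q > 0" "q * q = (real n + 1) * (real n + 2)" by (auto simp: q_def)
  have "\<bar>real n - lam\<bar> / (q * q) \<le> K\<^sup>2 / q"
    using * q(1) unfolding q_def[symmetric] by (simp add: field_simps)
  then have "\<bar>(real n - lam) / ((real n + 1) * (real n + 2))\<bar> \<le> K\<^sup>2 / q"
    using q by (simp add: abs_divide abs_mult)
  then have "\<bar>hcoeff c d lam (Suc (Suc n))\<bar> \<le> K\<^sup>2 / q * (K ^ n / sqrt (fact n))"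
    unfolding hcoeff.simps abs_mult[of _ "hcoeff c d lam n"] using ge2(1) q(1)
    by (intro mult_mono) auto
  also have "\<dots> = K ^ (Suc (Suc n)) / (q * sqrt (fact n))"
    by (simp add: power2_eq_square)
  also have "q * sqrt (fact n) = sqrt (fact (Suc (Suc n)))"
    unfolding q_def real_sqrt_mult[symmetric] by (simp add: algebra_simps)
  finally show ?case .
qed (use assms in auto)

lemma continuous_hcoeff: "continuous_on A (\<lambda>lam. hcoeff c d lam n)"
  by (induction n rule: induct_nat_012) (auto intro!: continuous_intros)

lemma hcoeff_nonneg: "lam \<le> 0 \<Longrightarrow> 0 \<le> c \<Longrightarrow> 0 \<le> d \<Longrightarrow> 0 \<le> hcoeff c d lam n"
  by (induction n rule: induct_nat_012) auto

lemma summable_power_over_sqrt_fact: "summable (\<lambda>n. x ^ n / sqrt (fact n) :: real)"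
proof -
  obtain N :: nat where N: "4 * x\<^sup>2 \<le> real N"
    using real_arch_simple by blast
  show ?thesis
  proof (rule summable_ratio_test[where c = "1/2" and N = N])
    fix n assume "N \<le> n"
    then have "(2 * \<bar>x\<bar>)\<^sup>2 \<le> real (Suc n)" using N by (simp add: power_mult_distrib)
    then have "2 * \<bar>x\<bar> \<le> sqrt (real (Suc n))" by (rule real_le_rsqrt)
    then have "\<bar>x\<bar> / sqrt (real (Suc n)) \<le> 1/2" by (simp add: field_simps)
    then have "\<bar>x\<bar> / sqrt (real (Suc n)) * (\<bar>x\<bar> ^ n / sqrt (fact n)) \<le> 1/2 * (\<bar>x\<bar> ^ n / sqrt (fact n))"
      by (intro mult_right_mono) auto
    then show "norm (x ^ Suc n / sqrt (fact (Suc n))) \<le> 1/2 * norm (x ^ n / sqrt (fact n))"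
      by (simp add: real_sqrt_mult abs_mult power_abs)
  qed simp
qed

lemma hcoeff_abs_le:
  assumes "\<bar>c\<bar> \<le> 1" "\<bar>d\<bar> \<le> 1" "\<bar>lam\<bar> \<le> M"
  shows "\<bar>hcoeff c d lam n\<bar> \<le> (M + 1) ^ n / sqrt (fact n)"
proof (rule hcoeff_bound)
  show "\<bar>lam\<bar> + 1 \<le> (M + 1)\<^sup>2" 
    using assms(3) by (simp add: power2_eq_square algebra_simps) (use mult_nonneg_nonneg[of M M] in linarith)
qed (use assms in auto)

lemma summable_hcoeff:
  assumes "\<bar>c\<bar> \<le> 1" "\<bar>d\<bar> \<le> 1"
  shows "summable (\<lambda>n. hcoeff c d lam n * s ^ n)"
proof (rule summable_comparison_test')
  fix n
  have "\<bar>hcoeff c d lam n\<bar> * \<bar>s\<bar> ^ n \<le> (\<bar>lam\<bar> + 1) ^ n / sqrt (fact n) * \<bar>s\<bar> ^ n"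
    by (intro mult_right_mono hcoeff_abs_le assms) auto
  then show "norm (hcoeff c d lam n * s ^ n) \<le> ((\<bar>lam\<bar> + 1) * \<bar>s\<bar>) ^ n / sqrt (fact n)"
    by (simp add: abs_mult power_abs power_mult_distrib)
qed (rule summable_power_over_sqrt_fact)

text \<open>The Weierstrass M-test with a majorant uniform in the parameter. Joint continuity in the
  point and the energy is what the compactness argument for the lowest levels consumes.\<close>

lemma continuous_on_powser_param:
  fixes a :: "real \<Rightarrow> nat \<Rightarrow> real"
  assumes "\<And>n. continuous_on {-M..M} (\<lambda>lam. a lam n)"
    and "\<And>lam n. \<bar>lam\<bar> \<le> M \<Longrightarrow> \<bar>a lam n\<bar> \<le> b n" "summable (\<lambda>n. b n * R ^ n)"
  shows "continuous_on ({-R..R} \<times> {-M..M}) (\<lambda>(s, lam). \<Sum>n. a lam n * s ^ n)"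
proof -
  have "uniform_limit ({-R..R} \<times> {-M..M}) (\<lambda>n p. \<Sum>i<n. a (snd p) i * fst p ^ i)
      (\<lambda>p. \<Sum>i. a (snd p) i * fst p ^ i) sequentially"
  proof (rule Weierstrass_m_test[OF _ assms(3)])
    fix n and p :: "real \<times> real"
    assume p: "p \<in> {-R..R} \<times> {-M..M}"
    show "norm (a (snd p) n * fst p ^ n) \<le> b n * R ^ n"
      unfolding norm_mult norm_power 
      by (intro mult_mono power_mono) (use p order_trans[OF abs_ge_zero assms(2)[of "snd p" n]] assms(2)[of "snd p" n] in auto)
  qed
  then show ?thesis unfolding case_prod_beta
    by (rule uniform_limit_theorem[rotated])
      (auto intro!: always_eventually continuous_intros continuous_on_compose2[OF assms(1)])
qed

text \<open>The Gaussian factor turns the Hermite solution for \<open>lam = E - 1/2\<close> into the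
  solution of \<open>w'' = (s\<^sup>2 / 4 - E) w\<close> with \<open>w(0) = c\<close> and
  \<open>w'(0) = d\<close>.\<close>

definition hosc :: "real \<Rightarrow> real \<Rightarrow> real \<Rightarrow> real \<Rightarrow> real" where
  "hosc c d E s = exp (- s\<^sup>2 / 4) * (\<Sum>n. hcoeff c d (E - 1/2) n * s ^ n)"

definition hosc' :: "real \<Rightarrow> real \<Rightarrow> real \<Rightarrow> real \<Rightarrow> real" where
  "hosc' c d E s = exp (- s\<^sup>2 / 4) * ((\<Sum>n. diffs (hcoeff c d (E - 1/2)) n * s ^ n)
     - s / 2 * (\<Sum>n. hcoeff c d (E - 1/2) n * s ^ n))"

lemma hosc_0 [simp]: "hosc c d E 0 = c"
  using powser_zero[of "hcoeff c d (E - 1/2)"] by (simp add: hosc_def)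

lemma hosc'_0 [simp]: "hosc' c d E 0 = d"
  using powser_zero[of "diffs (hcoeff c d (E - 1/2))"] by (simp add: hosc'_def diffs_def)

lemma hosc_has_derivative:
  assumes "\<bar>c\<bar> \<le> 1" "\<bar>d\<bar> \<le> 1"
  shows "(hosc c d E has_real_derivative hosc' c d E s) (at s)"
    and "(hosc' c d E has_real_derivative (s\<^sup>2 / 4 - E) * hosc c d E s) (at s)"
proof -
  define lam where "lam = E - 1/2"
  define a where "a = hcoeff c d lam"
  have sm: "summable (\<lambda>n. a n * y ^ n)" for y
    unfolding a_def by (rule summable_hcoeff[OF assms])
  have sm1: "summable (\<lambda>n. diffs a n * y ^ n)" for y
    by (rule termdiff_converges_all[OF sm])
  have sm2: "summable (\<lambda>n. diffs (diffs a) n * y ^ n)" for y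
    by (rule termdiff_converges_all[OF sm1])
  note D0 = termdiffs_strong_converges_everywhere[OF sm]
  note D1 = termdiffs_strong_converges_everywhere[OF sm1]
  let ?u = "\<lambda>s. \<Sum>n. a n * s ^ n" and ?u1 = "\<lambda>s. \<Sum>n. diffs a n * s ^ n"
  let ?u2 = "\<lambda>s. \<Sum>n. diffs (diffs a) n * s ^ n"
  \<comment> \<open>Hermite's equation, checked coefficient by coefficient: the recursion of
    \<open>hcoeff\<close> makes each of them vanish.\<close>
  have eq: "?u2 s - s * ?u1 s + lam * ?u s = 0"
  proof -
    have nsum: "(\<lambda>n. real n * a n * s ^ n) sums (s * ?u1 s)"
    proof -
      have "(\<lambda>n. s * (diffs a n * s ^ n)) sums (s * ?u1 s)"
        by (intro sums_mult summable_sums sm1)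
      then have "(\<lambda>n. real (Suc n) * a (Suc n) * s ^ (Suc n)) sums (s * ?u1 s)"
        by (simp add: diffs_def mult_ac)
      then show ?thesis by (subst (asm) sums_Suc_iff) simp
    qed
    have "(\<lambda>n. diffs (diffs a) n * s ^ n - real n * a n * s ^ n + lam * (a n * s ^ n)) sums (?u2 s - s * ?u1 s + lam * ?u s)"
      by (intro sums_add sums_diff sums_mult summable_sums sm sm2 nsum)
    moreover have "diffs (diffs a) n * s ^ n - real n * a n * s ^ n + lam * (a n * s ^ n) = 0" for n
    proof -
      have "diffs (diffs a) n = (real n - lam) * a n"
        unfolding diffs_def a_def hcoeff.simps by (simp add: divide_simps) (simp add: algebra_simps)
      then show ?thesis by simp (simp add: algebra_simps)
    qed
    ultimately have "(\<lambda>n. 0) sums (?u2 s - s * ?u1 s + lam * ?u s)" by simp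
    then show ?thesis by (rule sums_unique2[OF _ sums_zero])
  qed
  have e: "((\<lambda>s. exp (- s\<^sup>2 / 4)) has_real_derivative - s / 2 * exp (- s\<^sup>2 / 4)) (at s)" for s :: real
    by (auto intro!: derivative_eq_intros)
  show "(hosc c d E has_real_derivative hosc' c d E s) (at s)"
    unfolding hosc_def hosc'_def lam_def[symmetric] a_def[symmetric]
    by (rule DERIV_cong[OF DERIV_mult[OF e D0]]) (simp add: algebra_simps)
  have "((\<lambda>s. ?u1 s - s / 2 * ?u s) has_real_derivative (?u2 s - (1/2 * ?u s + ?u1 s * (s / 2)))) (at s)"
    by (rule DERIV_diff[OF D1 DERIV_mult[OF _ D0]]) (auto intro!: derivative_eq_intros)
  note D = DERIV_mult[OF e this]
  have u2: "?u2 s = s * ?u1 s - lam * ?u s" using eq by simp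
  show "(hosc' c d E has_real_derivative (s\<^sup>2 / 4 - E) * hosc c d E s) (at s)"
    unfolding hosc_def hosc'_def lam_def[symmetric] a_def[symmetric]
    by (rule DERIV_cong[OF D], unfold u2) (simp add: lam_def field_simps power2_eq_square)
qed


text \<open>The products \<open>f' s * g' s\<close> cancel and only the difference of the two
  potentials survives. The comparisons of energies below read a sign off this derivative.\<close>

lemma wronskian_has_derivative:
  assumes "(f has_real_derivative f' s) (at s)" "(f' has_real_derivative p * f s) (at s)"
    and "(g has_real_derivative g' s) (at s)" "(g' has_real_derivative q * g s) (at s)"
  shows "((\<lambda>s. f s * g' s - f' s * g s) has_real_derivative (q - p) * f s * g s) (at s)"
  by (rule DERIV_cong[OF DERIV_diff[OF DERIV_mult[OF assms(1,4)] DERIV_mult[OF assms(2,3)]]])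
    (simp add: algebra_simps)

lemma hosc_continuous_param:
  assumes "\<bar>c\<bar> \<le> 1" "\<bar>d\<bar> \<le> 1"
  shows "continuous_on ({0..R} \<times> {-M..M}) (\<lambda>(s, E). hosc c d E s)"
proof -
  have "continuous_on ({-R..R} \<times> {-(M+1)..M+1}) (\<lambda>(s, lam). \<Sum>n. hcoeff c d lam n * s ^ n)"
  proof (rule continuous_on_powser_param)
    show "summable (\<lambda>n. ((M + 1) + 1) ^ n / sqrt (fact n) * R ^ n)"
      using summable_power_over_sqrt_fact[of "((M + 1) + 1) * R"] by (simp add: power_mult_distrib)
  qed (intro continuous_hcoeff hcoeff_abs_le assms | assumption)+
  then have "continuous_on ({0..R} \<times> {-M..M})
      (\<lambda>p. (\<lambda>(s, lam). \<Sum>n. hcoeff c d lam n * s ^ n) (fst p, snd p - 1/2))"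
    by (rule continuous_on_compose2) (auto intro!: continuous_intros)
  then show ?thesis
    unfolding hosc_def case_prod_beta by (auto intro!: continuous_intros)
qed

text \<open>The odd solution divided by \<open>s\<close>, with its removable singularity at \<open>0\<close> filled in.\<close>

definition odd_quot :: "real \<Rightarrow> real \<Rightarrow> real" where
  "odd_quot E s = exp (- s\<^sup>2 / 4) * (\<Sum>n. hcoeff 0 1 (E - 1/2) (Suc n) * s ^ n)"

lemma odd_quot_0 [simp]: "odd_quot E 0 = 1"
  using powser_zero[of "\<lambda>n. hcoeff 0 1 (E - 1/2) (Suc n)"] by (simp add: odd_quot_def)

lemma summable_hcoeff_Suc:
  assumes "\<bar>c\<bar> \<le> 1" "\<bar>d\<bar> \<le> 1"
  shows "summable (\<lambda>n. hcoeff c d lam (Suc n) * s ^ n)"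
proof (cases "s = 0")
  case False
  have "summable (\<lambda>n. hcoeff c d lam (Suc n) * s ^ (Suc n))"
    using summable_hcoeff[OF assms, of lam s] by (subst summable_Suc_iff)
  then have "summable (\<lambda>n. s * (hcoeff c d lam (Suc n) * s ^ n))"
    by (simp add: mult_ac)
  then show ?thesis using False by (simp add: summable_cmult_iff)
qed auto

lemma hosc_eq_odd_quot: "hosc 0 1 E s = s * odd_quot E s"
proof -
  have "(\<Sum>n. hcoeff 0 1 (E - 1/2) n * s ^ n) = s * (\<Sum>n. hcoeff 0 1 (E - 1/2) (Suc n) * s ^ n)"
    using suminf_split_head[OF summable_hcoeff[of 0 1 "E - 1/2" s]]
      suminf_mult[OF summable_hcoeff_Suc[of 0 1 "E - 1/2" s], of s]
    by (simp add: mult_ac)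
  then show ?thesis by (simp add: hosc_def odd_quot_def)
qed

lemma odd_quot_continuous_param:
  "continuous_on ({0..R} \<times> {-M..M}) (\<lambda>(s, E). odd_quot E s)"
proof -
  have "continuous_on ({-R..R} \<times> {-(M+1)..M+1}) (\<lambda>(s, lam). \<Sum>n. hcoeff 0 1 lam (Suc n) * s ^ n)"
  proof (rule continuous_on_powser_param)
    fix lam :: real and n
    assume lam: "\<bar>lam\<bar> \<le> M + 1"
    then have "\<bar>hcoeff 0 1 lam (Suc n)\<bar> \<le> ((M + 1) + 1) ^ Suc n / sqrt (fact (Suc n))"
      by (intro hcoeff_abs_le) auto
    also have "\<dots> \<le> ((M + 1) + 1) ^ Suc n / sqrt (fact n)"
      using lam by (intro divide_left_mono real_sqrt_le_mono) (auto intro!: fact_mono)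
    finally show "\<bar>hcoeff 0 1 lam (Suc n)\<bar> \<le> ((M + 1) + 1) ^ Suc n / sqrt (fact n)" .
  next
    show "summable (\<lambda>n. ((M + 1) + 1) ^ Suc n / sqrt (fact n) * R ^ n)"
      using summable_mult[OF summable_power_over_sqrt_fact[of "((M + 1) + 1) * R"], of "(M + 1) + 1"]
      by (simp add: power_mult_distrib mult.assoc)
  qed (rule continuous_hcoeff)
  then have "continuous_on ({0..R} \<times> {-M..M})
      (\<lambda>p. (\<lambda>(s, lam). \<Sum>n. hcoeff 0 1 lam (Suc n) * s ^ n) (fst p, snd p - 1/2))"
    by (rule continuous_on_compose2) (auto intro!: continuous_intros)
  then show ?thesis
    unfolding odd_quot_def case_prod_beta by (auto intro!: continuous_intros)
qed

lemma powser_ge_head: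
  fixes a :: "nat \<Rightarrow> real"
  assumes "\<And>n. 0 \<le> a n" "0 \<le> s" "summable (\<lambda>n. a n * s ^ n)"
  shows "a 0 \<le> (\<Sum>n. a n * s ^ n)"
  using sum_le_suminf[OF assms(3), of "{0}"] assms(1,2) by simp

text \<open>For \<open>E \<le> 1/2\<close> all factors of the recursion are nonnegative, so the
  series is at least its first coefficient. This bounds from below the energies at which a zero can
  occur.\<close>

lemma hosc_pos_low:
  assumes "E \<le> 1/2" "0 \<le> s"
  shows "0 < hosc 1 0 E s"
proof -
  have "hcoeff 1 0 (E - 1/2) 0 \<le> (\<Sum>n. hcoeff 1 0 (E - 1/2) n * s ^ n)"
    by (intro powser_ge_head hcoeff_nonneg summable_hcoeff) (use assms in auto)
  then show ?thesis by (simp add: hosc_def)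
qed

lemma odd_quot_pos_low:
  assumes "E \<le> 1/2" "0 \<le> s"
  shows "0 < odd_quot E s"
proof -
  have "hcoeff 0 1 (E - 1/2) (Suc 0) \<le> (\<Sum>n. hcoeff 0 1 (E - 1/2) (Suc n) * s ^ n)"
    by (intro powser_ge_head hcoeff_nonneg summable_hcoeff_Suc) (use assms in auto)
  then show ?thesis by (simp add: odd_quot_def)
qed

section \<open>The lowest energy at which a family of functions stops being positive\<close>

text \<open>Applied to \<open>even_sol\<close> this becomes the first Dirichlet level of
  \<open>(-L, L)\<close>, applied to \<open>odd_quot\<close> the second.\<close>

definition first_level :: "(real \<Rightarrow> real \<Rightarrow> real) \<Rightarrow> real \<Rightarrow> real" where
  "first_level f L = Inf {E. \<exists>s\<in>{0..L}. f E s \<le> 0}"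

text \<open>By compactness the infimum is attained at some \<open>\<mu>\<close>. There the function
  is nonnegative, as a limit of positive values from lower energies, and \<open>touch\<close> would
  turn an interior zero into a negative value; so the only zero left is the endpoint
  \<open>L\<close>.\<close>

lemma first_level:
  fixes f :: "real \<Rightarrow> real \<Rightarrow> real"
  assumes cont: "\<And>M. continuous_on ({0..L} \<times> {-M..M}) (\<lambda>(s, E). f E s)"
    and low: "\<And>s E. 0 \<le> s \<Longrightarrow> E \<le> E0 \<Longrightarrow> 0 < f E s"
    and f0: "\<And>E. 0 < f E 0"
    and E1: "s1 \<in> {0..L}" "f E1 s1 \<le> 0"
    and touch: "\<And>z E. 0 < z \<Longrightarrow> z < L \<Longrightarrow> f E z = 0 \<Longrightarrow> \<exists>z'\<in>{0..L}. f E z' < 0"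
  shows "\<And>E s. E < first_level f L \<Longrightarrow> s \<in> {0..L} \<Longrightarrow> 0 < f E s"
    and "\<And>s. s \<in> {0..<L} \<Longrightarrow> 0 < f (first_level f L) s"
    and "f (first_level f L) L = 0"
    and "first_level f L \<le> E1"
proof -
  define Z where "Z = {E. \<exists>s\<in>{0..L}. f E s \<le> 0}"
  \<comment> \<open>Every energy of \<open>Z\<close> up to \<open>M\<close> lies in the window
    \<open>[-M, M]\<close>, since \<open>low\<close> excludes those up to \<open>E0\<close>; and
    \<open>E1\<close> lies in it as well.\<close>
  define M where "M = max \<bar>E0\<bar> \<bar>E1\<bar>"
  define K where "K = snd ` {p \<in> {0..L} \<times> {-M..M}. (\<lambda>(s, E). f E s) p \<le> 0}"
  have KI: "E \<in> K" if "s \<in> {0..L}" "\<bar>E\<bar> \<le> M" "f E s \<le> 0" for E s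
    unfolding K_def by (rule image_eqI[of _ _ "(s, E)"]) (use that in auto)
  have "closed ({p \<in> {0..L} \<times> {-M..M}. (\<lambda>(s, E). f E s) p \<le> (\<lambda>_. 0) p})"
    by (intro continuous_on_closed_Collect_le cont) (auto intro!: closed_Times)
  moreover have "bounded {p \<in> {0..L} \<times> {-M..M}. (\<lambda>(s, E). f E s) p \<le> (\<lambda>_. 0) p}"
    by (rule bounded_subset[of "{0..L} \<times> {-M..M}"]) (auto intro!: bounded_Times)
  ultimately have "compact {p \<in> {0..L} \<times> {-M..M}. (\<lambda>(s, E). f E s) p \<le> 0}"
    by (simp add: compact_eq_bounded_closed)
  then have "compact K" unfolding K_def
    by (rule compact_continuous_image[rotated]) (auto intro!: continuous_intros)
  moreover have "E1 \<in> K" using E1 by (intro KI) (auto simp: M_def)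
  ultimately have "\<exists>\<mu>\<in>K. \<forall>E\<in>K. \<mu> \<le> E"
    by (intro compact_attains_inf) auto
  then obtain \<mu> where \<mu>: "\<mu> \<in> K" "\<And>E. E \<in> K \<Longrightarrow> \<mu> \<le> E" by blast
  obtain p where p: "p \<in> {0..L} \<times> {-M..M}" "(\<lambda>(s, E). f E s) p \<le> 0" "\<mu> = snd p"
    using \<mu>(1) unfolding K_def by (elim imageE) blast
  have "\<mu> \<in> Z" unfolding Z_def mem_Collect_eq
    by (rule bexI[of _ "fst p"]) (use p in \<open>auto simp: case_prod_beta\<close>)
  have le: "\<mu> \<le> E" if "E \<in> Z" for E
  proof (cases "E \<le> M")
    case True
    obtain s where s: "s \<in> {0..L}" "f E s \<le> 0" using \<open>E \<in> Z\<close> by (auto simp: Z_def)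
    then have "E0 < E" using low[of s E] by (meson atLeastAtMost_iff leD leI) 
    with True have "E \<in> K" using s by (intro KI) (auto simp: M_def)
    then show ?thesis by (rule \<mu>)
  next
    case False
    then show ?thesis using \<mu>(2)[OF \<open>E1 \<in> K\<close>] by (simp add: M_def)
  qed
  have fl: "first_level f L = \<mu>"
    unfolding first_level_def Z_def[symmetric] using \<open>\<mu> \<in> Z\<close> le by (rule cInf_eq_minimum)
  show pos: "0 < f E s" if "E < first_level f L" "s \<in> {0..L}" for E s
  proof (rule ccontr)
    assume "\<not> 0 < f E s"
    then have "E \<in> Z" unfolding Z_def using that(2) by (auto simp: not_less)
    then show False using le[of E] that(1) fl by simp
  qed
  have nonneg: "0 \<le> f \<mu> s" if s: "s \<in> {0..L}" for s
  proof -
    let ?M = "\<bar>\<mu>\<bar> + 1"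
    have "continuous_on {-?M..?M} (\<lambda>E. (\<lambda>(s, E). f E s) (s, E))"
      by (rule continuous_on_compose2[OF cont[of ?M]]) (use s in \<open>auto intro!: continuous_intros\<close>)
    then have "isCont (\<lambda>E. f E s) \<mu>"
      by (auto intro!: continuous_on_interior[where S = "{-?M..?M}"])
    then have "((\<lambda>E. f E s) \<longlongrightarrow> f \<mu> s) (at_left \<mu>)"
      by (auto simp: isCont_def intro: tendsto_within_subset)
    then show ?thesis
    proof (rule tendsto_lowerbound)
      show "\<forall>\<^sub>F E in at_left \<mu>. 0 \<le> f E s"
        using pos[OF _ s] unfolding fl eventually_at_filter by (auto intro!: always_eventually less_imp_le)
    qed auto
  qed
  have zero: "z = L" if "z \<in> {0..L}" "f \<mu> z \<le> 0" for z
  proof (rule ccontr)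
    assume "z \<noteq> L"
    moreover have "z \<noteq> 0" using that(2) f0[of \<mu>] by auto
    ultimately have "0 < z" "z < L" using that(1) by auto
    moreover have "f \<mu> z = 0" using nonneg[OF that(1)] that(2) by simp
    ultimately obtain z' where "z' \<in> {0..L}" "f \<mu> z' < 0" 
      using touch[of z \<mu>] by blast
    then show False using nonneg[of z'] by simp
  qed
  show "0 < f (first_level f L) s" if "s \<in> {0..<L}" for s
    using zero[of s] that unfolding fl by (cases "f \<mu> s \<le> 0") auto
  obtain z where "z \<in> {0..L}" "f \<mu> z \<le> 0" using \<open>\<mu> \<in> Z\<close> by (auto simp: Z_def)
  then show "f (first_level f L) L = 0"
    using zero[of z] nonneg[of z] unfolding fl by simp
  show "first_level f L \<le> E1" using le[of E1] E1 unfolding fl Z_def by blast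
qed


section \<open>Even and odd solutions, their Wronskian and the initial value problem\<close>

abbreviation "even_sol \<equiv> hosc 1 0"
abbreviation "even_sol' \<equiv> hosc' 1 0"
abbreviation "odd_sol \<equiv> hosc 0 1"
abbreviation "odd_sol' \<equiv> hosc' 0 1"

lemmas even_sol_DERIV = hosc_has_derivative[of 1 0, simplified]
lemmas odd_sol_DERIV = hosc_has_derivative[of 0 1, simplified]

lemma hosc_continuous_on:
  assumes "\<bar>c\<bar> \<le> 1" "\<bar>d\<bar> \<le> 1"
  shows "continuous_on A (hosc c d E)" "continuous_on A (hosc' c d E)"
  by (rule DERIV_continuous_on, rule DERIV_subset[OF hosc_has_derivative(1)] DERIV_subset[OF hosc_has_derivative(2)];
      use assms in simp)+

lemmas even_sol_cont = hosc_continuous_on[of 1 0, simplified]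
lemmas odd_sol_cont = hosc_continuous_on[of 0 1, simplified]

text \<open>Both solutions belong to the same energy, so the Wronskian is constant, and at
  \<open>0\<close> it is \<open>1 * 1 - 0 * 0\<close>. In particular the zeros of either solution
  are simple.\<close>

lemma wronskian_even_odd: "even_sol E s * odd_sol' E s - even_sol' E s * odd_sol E s = 1"
proof -
  have "((\<lambda>s. even_sol E s * odd_sol' E s - even_sol' E s * odd_sol E s) has_real_derivative 0) (at s)" for s
    by (rule DERIV_cong[OF wronskian_has_derivative[OF even_sol_DERIV odd_sol_DERIV]]) simp
  then show ?thesis
    using DERIV_isconst_all[of "\<lambda>s. even_sol E s * odd_sol' E s - even_sol' E s * odd_sol E s" s 0]
    by simp
qed

text \<open>The Wronskians of \<open>f\<close> with both basic solutions are constant; Cramer's rule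
  with determinant \<open>1\<close> recovers \<open>f s\<close>.\<close>

lemma schrodinger_ivp:
  fixes a :: real
  assumes "\<And>s. \<bar>s\<bar> < a \<Longrightarrow> (f has_real_derivative f' s) (at s)"
    and "\<And>s. \<bar>s\<bar> < a \<Longrightarrow> (f' has_real_derivative (s\<^sup>2 / 4 - E) * f s) (at s)"
    and s: "\<bar>s\<bar> < a"
  shows "f s = f 0 * even_sol E s + f' 0 * odd_sol E s"
proof -
  have "f s * g' s - f' s * g s = f 0 * g' 0 - f' 0 * g 0"
    if g: "\<And>s. (g has_real_derivative g' s) (at s)"
      "\<And>s. (g' has_real_derivative (s\<^sup>2 / 4 - E) * g s) (at s)" for g g'
  proof -
    have "((\<lambda>s. f s * g' s - f' s * g s) has_real_derivative 0) (at t within {-a<..<a})"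
      if "t \<in> {-a<..<a}" for t
      by (rule has_field_derivative_at_within,
          rule DERIV_cong[OF wronskian_has_derivative[OF assms(1,2) g]]) (use that in auto)
    then obtain c where "\<And>t. t \<in> {-a<..<a} \<Longrightarrow> f t * g' t - f' t * g t = c"
      using has_field_derivative_zero_constant[of "{-a<..<a}" "\<lambda>s. f s * g' s - f' s * g s"] by auto
    from this[of s] this[of 0] show ?thesis using s by (simp add: abs_less_iff)
  qed
  from this[OF even_sol_DERIV] this[OF odd_sol_DERIV]
  have *: "f' s * even_sol E s - f s * even_sol' E s = f' 0"
     "f s * odd_sol' E s - f' s * odd_sol E s = f 0" by simp_all
  have "f 0 * even_sol E s + f' 0 * odd_sol E s 
    = f s * (even_sol E s * odd_sol' E s - even_sol' E s * odd_sol E s)"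
    unfolding *[symmetric] by (simp add: algebra_simps)
  then show ?thesis by (simp add: wronskian_even_odd)
qed

text \<open>The potential is even, so the reflected function solves the same equation, with the
  opposite initial slope.\<close>

lemma hosc_reflect:
  assumes "\<bar>c\<bar> \<le> 1" "\<bar>d\<bar> \<le> 1"
  shows "hosc c d E (-s) = c * even_sol E s - d * odd_sol E s"
proof -
  have "hosc c d E (-s) = hosc c d E (-0) * even_sol E s + (- hosc' c d E (-0)) * odd_sol E s"
  proof (rule schrodinger_ivp[where f = "\<lambda>s. hosc c d E (-s)" and f' = "\<lambda>s. - hosc' c d E (-s)" and a = "\<bar>s\<bar> + 1"])
    show "((\<lambda>s. hosc c d E (-s)) has_real_derivative - hosc' c d E (-t)) (at t)" for t
      using hosc_has_derivative(1)[OF assms] by (subst DERIV_mirror[symmetric])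
    show "((\<lambda>s. - hosc' c d E (-s)) has_real_derivative (t\<^sup>2 / 4 - E) * hosc c d E (-t)) (at t)" for t
      using DERIV_minus[OF DERIV_mirror[THEN iffD1, OF hosc_has_derivative(2)[OF assms, of E "-t"]]]
      by simp
  qed simp
  then show ?thesis by simp
qed

lemma even_sol_minus [simp]: "even_sol E (-s) = even_sol E s"
  and odd_sol_minus [simp]: "odd_sol E (-s) = - odd_sol E s"
  by (simp_all add: hosc_reflect)

lemma even_sol'_minus [simp]: "even_sol' E (-s) = - even_sol' E s"
  using DERIV_unique[OF DERIV_mirror[THEN iffD1, OF even_sol_DERIV(1)[of E "-s"]], of "even_sol' E s"]
    even_sol_DERIV(1)[of E s] by simp

lemma odd_sol'_minus [simp]: "odd_sol' E (-s) = odd_sol' E s"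
  using DERIV_unique[OF DERIV_mirror[THEN iffD1, OF odd_sol_DERIV(1)[of E "-s"]], of "- odd_sol' E s"]
    DERIV_minus[OF odd_sol_DERIV(1)[of E s]] by simp

text \<open>A simple zero is a change of sign; this is how the hypothesis \<open>touch\<close> of
  \<open>first_level\<close> is met.\<close>

lemma DERIV_nonzero_crossing:
  fixes f :: "real \<Rightarrow> real"
  assumes "(f has_real_derivative d) (at z)" "d \<noteq> 0" "f z = 0" "0 < z" "z < L"
  shows "\<exists>z'. 0 < z' \<and> z' < L \<and> f z' < 0"
proof (cases "d < 0")
  case True
  obtain e where "e > 0" "\<And>h. 0 < h \<Longrightarrow> h < e \<Longrightarrow> f (z + h) < f z"
    using DERIV_neg_dec_right[OF assms(1) True] by blast
  moreover define h where "h = min e (L - z) / 2"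
  moreover have "0 < h" "h < e" "h < L - z" using \<open>e > 0\<close> assms(5) by (auto simp: h_def min_def)
  ultimately show ?thesis using assms by (intro exI[of _ "z + h"]) auto
next
  case False
  then have "d > 0" using assms by simp
  then obtain e where "e > 0" "\<And>h. 0 < h \<Longrightarrow> h < e \<Longrightarrow> f (z - h) < f z"
    using DERIV_pos_inc_left[OF assms(1)] by blast
  moreover define h where "h = min e z / 2"
  moreover have "0 < h" "h < e" "h < z" using \<open>e > 0\<close> assms(4) by (auto simp: h_def min_def)
  ultimately show ?thesis using assms by (intro exI[of _ "z - h"]) auto
qed

section \<open>Existence of the even and odd levels\<close>

definition even_level :: "real \<Rightarrow> real" where
  "even_level L = first_level even_sol L"

definition odd_level :: "real \<Rightarrow> real" where
  "odd_level L = first_level odd_quot L"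

text \<open>Comparison with \<open>cos (k * s)\<close>, which is positive on \<open>[0, L)\<close>
  and vanishes at \<open>L\<close>. If \<open>even_sol E\<close> stayed positive, the Wronskian
  would decrease strictly from \<open>0\<close>, because \<open>E\<close> exceeds
  \<open>k\<^sup>2\<close> plus the largest value of the potential; yet at \<open>L\<close> it
  equals \<open>k * even_sol E L > 0\<close>.\<close>

lemma even_sol_has_zero:
  assumes "0 < L" "(pi / (2 * L))\<^sup>2 + L\<^sup>2 / 4 < E"
  shows "\<exists>s\<in>{0..L}. even_sol E s \<le> 0"
proof (rule ccontr)
  assume "\<not> ?thesis"
  then have neg: "even_sol E s > 0" if "0 \<le> s" "s \<le> L" for s
    using that by (meson atLeastAtMost_iff not_le)
  define k where "k = pi / (2 * L)"
  have k: "k > 0" "k * L = pi / 2" using assms by (auto simp: k_def)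
  let ?w = "\<lambda>s. cos (k * s) * even_sol' E s - (- k * sin (k * s)) * even_sol E s"
  have w: "(?w has_real_derivative (s\<^sup>2 / 4 - E - (- k\<^sup>2)) * cos (k * s) * even_sol E s) (at s)" for s
    by (rule wronskian_has_derivative[OF _ _ even_sol_DERIV]) 
      (auto intro!: derivative_eq_intros simp: power2_eq_square)
  have "?w L < ?w 0"
  proof (rule DERIV_neg_imp_decreasing_open[OF assms(1)])
    fix s assume s: "0 < s" "s < L"
    have "even_sol E s > 0" using neg s by simp
    moreover have "k * s < pi / 2" using s(2) k mult_strict_left_mono[of s L k] by metis
    then have "cos (k * s) > 0" using s k by (intro cos_gt_zero) auto
    moreover have "s\<^sup>2 < L\<^sup>2" using s by (simp add: power_strict_mono)
    then have "s\<^sup>2 / 4 - E - (- k\<^sup>2) < 0" using assms(2) unfolding k_def by linarith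
    ultimately have "(s\<^sup>2 / 4 - E - (- k\<^sup>2)) * cos (k * s) * even_sol E s < 0"
      by (simp add: mult_neg_pos)
    then show "\<exists>y. DERIV ?w s :> y \<and> y < 0" using w by blast
  next
    show "continuous_on {0..L} ?w"
      by (rule DERIV_continuous_on, rule DERIV_subset[OF w]) auto
  qed
  moreover have "?w L = k * even_sol E L" by (simp add: k)
  moreover have "even_sol E L > 0" using neg assms by simp
  ultimately show False using k(1) by (simp add: mult_less_0_iff)
qed

text \<open>The same comparison, now with \<open>sin (pi * s / L)\<close>, the lowest odd mode of a
  free string on \<open>[-L, L]\<close>.\<close>

lemma odd_quot_has_zero:
  assumes "0 < L" "(pi / L)\<^sup>2 + L\<^sup>2 / 4 < E"
  shows "\<exists>s\<in>{0..L}. odd_quot E s \<le> 0"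
proof (rule ccontr)
  assume "\<not> ?thesis"
  then have "odd_quot E s > 0" if "0 \<le> s" "s \<le> L" for s
    using that by (meson atLeastAtMost_iff not_le)
  then have pos: "odd_sol E s > 0" if "0 < s" "s \<le> L" for s
    using that by (simp add: hosc_eq_odd_quot)
  define k where "k = pi / L"
  have k: "k > 0" "k * L = pi" using assms by (auto simp: k_def)
  let ?w = "\<lambda>s. sin (k * s) * odd_sol' E s - (k * cos (k * s)) * odd_sol E s"
  have w: "(?w has_real_derivative (s\<^sup>2 / 4 - E - (- k\<^sup>2)) * sin (k * s) * odd_sol E s) (at s)" for s
    by (rule wronskian_has_derivative[OF _ _ odd_sol_DERIV]) 
      (auto intro!: derivative_eq_intros simp: power2_eq_square)
  have "?w L < ?w 0"
  proof (rule DERIV_neg_imp_decreasing_open[OF assms(1)])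
    fix s assume s: "0 < s" "s < L"
    have "odd_sol E s > 0" using pos s by simp
    moreover have "k * s < pi" using s(2) k mult_strict_left_mono[of s L k] by metis
    then have "sin (k * s) > 0" using s k by (intro sin_gt_zero) auto
    moreover have "s\<^sup>2 < L\<^sup>2" using s by (simp add: power_strict_mono)
    then have "s\<^sup>2 / 4 - E - (- k\<^sup>2) < 0" using assms(2) unfolding k_def by linarith
    ultimately have "(s\<^sup>2 / 4 - E - (- k\<^sup>2)) * sin (k * s) * odd_sol E s < 0"
      by (simp add: mult_neg_pos)
    then show "\<exists>y. DERIV ?w s :> y \<and> y < 0" using w by blast
  next
    show "continuous_on {0..L} ?w"
      by (rule DERIV_continuous_on, rule DERIV_subset[OF w]) auto
  qed
  moreover have "?w L = k * odd_sol E L" by (simp add: k)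
  moreover have "odd_sol E L > 0" using pos assms by simp
  ultimately show False using k(1) by (simp add: mult_less_0_iff)
qed

lemma even_level_first_level:
  assumes "0 < L" "s1 \<in> {0..L}" "even_sol E1 s1 \<le> 0"
  shows "E < even_level L \<Longrightarrow> s \<in> {0..L} \<Longrightarrow> 0 < even_sol E s"
    and "s \<in> {0..<L} \<Longrightarrow> 0 < even_sol (even_level L) s"
    and "even_sol (even_level L) L = 0"
    and "even_level L \<le> E1"
proof -
  have touch: "\<exists>z'\<in>{0..L}. even_sol E z' < 0" if "0 < z" "z < L" "even_sol E z = 0" for z E
  proof -
    \<comment> \<open>If value and slope vanished together, the Wronskian would be \<open>0\<close>
      instead of \<open>1\<close>.\<close>
    have "even_sol' E z \<noteq> 0" using wronskian_even_odd[of E z] that by auto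
    then show ?thesis 
      using DERIV_nonzero_crossing[OF even_sol_DERIV(1) _ that(3,1,2)] by (meson atLeastAtMost_iff less_imp_le)
  qed
  have c: "continuous_on ({0..L} \<times> {-M..M}) (\<lambda>(s, E). even_sol E s)" for M
    by (rule hosc_continuous_param) auto
  note * = first_level[OF c hosc_pos_low _ assms(2,3) touch]
  show "E < even_level L \<Longrightarrow> s \<in> {0..L} \<Longrightarrow> 0 < even_sol E s"
     "s \<in> {0..<L} \<Longrightarrow> 0 < even_sol (even_level L) s"
     "even_sol (even_level L) L = 0" "even_level L \<le> E1"
    unfolding even_level_def by (rule *[where ?E0.0 = "1/2"]; simp)+
qed

lemma odd_level_first_level:
  assumes "0 < L" "s1 \<in> {0..L}" "odd_quot E1 s1 \<le> 0"
  shows "E < odd_level L \<Longrightarrow> s \<in> {0..L} \<Longrightarrow> 0 < odd_quot E s"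
    and "s \<in> {0..<L} \<Longrightarrow> 0 < odd_quot (odd_level L) s"
    and "odd_quot (odd_level L) L = 0"
proof -
  have touch: "\<exists>z'\<in>{0..L}. odd_quot E z' < 0" if zL: "0 < z" "z < L" and "odd_quot E z = 0" for z E
  proof -
    have z: "odd_sol E z = 0" using that by (simp add: hosc_eq_odd_quot)
    then have "odd_sol' E z \<noteq> 0" using wronskian_even_odd[of E z] by auto
    then obtain z' where "0 < z'" "z' < L" "odd_sol E z' < 0"
      using DERIV_nonzero_crossing[OF odd_sol_DERIV(1) _ z, of L] zL by force
    then show ?thesis by (force simp: hosc_eq_odd_quot mult_less_0_iff)
  qed
  note * = first_level[OF odd_quot_continuous_param odd_quot_pos_low _ assms(2,3) touch]
  show "E < odd_level L \<Longrightarrow> s \<in> {0..L} \<Longrightarrow> 0 < odd_quot E s"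
     "s \<in> {0..<L} \<Longrightarrow> 0 < odd_quot (odd_level L) s"
     "odd_quot (odd_level L) L = 0"
    unfolding odd_level_def by (rule *[where ?E0.0 = "1/2"]; simp)+
qed

section \<open>Dirichlet levels of an interval\<close>

text \<open>If \<open>f2\<close> were positive, \<open>f'\<close> would be positive just to the
  right of its zero \<open>x\<close>, and \<open>f\<close> would exceed its maximum there.\<close>

lemma second_derivative_at_max:
  fixes f :: "real \<Rightarrow> real"
  assumes "0 < d" and f: "\<And>t. \<bar>t - x\<bar> < d \<Longrightarrow> (f has_real_derivative f' t) (at t)"
    and f': "(f' has_real_derivative f2) (at x)"
    and max: "\<And>t. \<bar>t - x\<bar> < d \<Longrightarrow> f t \<le> f x"
  shows "f' x = 0" "f2 \<le> 0"
proof -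
  show f'0: "f' x = 0"
    by (rule DERIV_local_max[OF f \<open>0 < d\<close>]) (use \<open>0 < d\<close> max in \<open>auto simp: abs_minus_commute\<close>)
  show "f2 \<le> 0"
  proof (rule ccontr)
    assume "\<not> f2 \<le> 0"
    then obtain e where e: "e > 0" "\<And>h. 0 < h \<Longrightarrow> h < e \<Longrightarrow> f' x < f' (x + h)"
      using DERIV_pos_inc_right[OF f'] by force
    define h where "h = min d e / 2"
    have h: "0 < h" "h < d" "h < e" using e(1) \<open>0 < d\<close> by (auto simp: h_def min_def)
    have "f x < f (x + h)"
    proof (rule DERIV_pos_imp_increasing_open[of x "x + h" f])
      show "\<exists>y. DERIV f t :> y \<and> 0 < y" if "x < t" "t < x + h" for t
        using f[of t] e(2)[of "t - x"] that h f'0 by auto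
      show "continuous_on {x..x + h} f"
        by (rule DERIV_continuous_on, rule DERIV_subset[OF f]) (use h in auto)
    qed (use h in simp)
    then show False using max[of "x + h"] h by simp
  qed
qed

context
  fixes L :: real
  assumes L: "0 < L"
begin

text \<open>\<open>even_sol_has_zero\<close> demands a strict inequality, hence the passage through
  all larger energies.\<close>

lemma even_level_le: "even_level L \<le> (pi / (2 * L))\<^sup>2 + L\<^sup>2 / 4"
proof (rule dense_ge)
  fix E assume "(pi / (2 * L))\<^sup>2 + L\<^sup>2 / 4 < E"
  then obtain s where "s \<in> {0..L}" "even_sol E s \<le> 0"
    using even_sol_has_zero[OF L] by blast
  then show "even_level L \<le> E" by (rule even_level_first_level(4)[OF L])
qed

lemma even_sol_abs: "even_sol E \<bar>s\<bar> = even_sol E s"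
  by (simp add: abs_if)

lemma even_sol_pos:
  assumes "E < even_level L" "\<bar>s\<bar> \<le> L"
  shows "0 < even_sol E s"
proof -
  \<comment> \<open>\<open>even_level_first_level\<close> asks for some energy with a nonpositive
    value; the \<open>+ 1\<close> puts it beyond the bound of
    \<open>even_sol_has_zero\<close>.\<close>
  obtain s1 where "s1 \<in> {0..L}" "even_sol ((pi / (2 * L))\<^sup>2 + L\<^sup>2 / 4 + 1) s1 \<le> 0"
    using even_sol_has_zero[OF L, of "(pi / (2 * L))\<^sup>2 + L\<^sup>2 / 4 + 1"] by auto
  from even_level_first_level(1)[OF L this assms(1), of "\<bar>s\<bar>"] assms(2)
  show ?thesis by (simp add: even_sol_abs)
qed

lemma even_level_sol_pos:
  assumes "\<bar>s\<bar> < L"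
  shows "0 < even_sol (even_level L) s"
proof -
  obtain s1 where "s1 \<in> {0..L}" "even_sol ((pi / (2 * L))\<^sup>2 + L\<^sup>2 / 4 + 1) s1 \<le> 0"
    using even_sol_has_zero[OF L, of "(pi / (2 * L))\<^sup>2 + L\<^sup>2 / 4 + 1"] by auto
  from even_level_first_level(2)[OF L this, of "\<bar>s\<bar>"] assms
  show ?thesis by (simp add: even_sol_abs)
qed

lemma even_level_sol_zero [simp]: "even_sol (even_level L) L = 0"
proof -
  obtain s1 where "s1 \<in> {0..L}" "even_sol ((pi / (2 * L))\<^sup>2 + L\<^sup>2 / 4 + 1) s1 \<le> 0"
    using even_sol_has_zero[OF L, of "(pi / (2 * L))\<^sup>2 + L\<^sup>2 / 4 + 1"] by auto
  from even_level_first_level(3)[OF L this] show ?thesis .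
qed

lemma odd_sol_pos:
  assumes "E < odd_level L" "0 < s" "s \<le> L"
  shows "0 < odd_sol E s"
proof -
  obtain s1 where "s1 \<in> {0..L}" "odd_quot ((pi / L)\<^sup>2 + L\<^sup>2 / 4 + 1) s1 \<le> 0"
    using odd_quot_has_zero[OF L, of "(pi / L)\<^sup>2 + L\<^sup>2 / 4 + 1"] by auto
  from odd_level_first_level(1)[OF L this assms(1), of s] assms(2,3)
  show ?thesis by (simp add: hosc_eq_odd_quot)
qed

lemma odd_level_sol_pos:
  assumes "0 < s" "s < L"
  shows "0 < odd_sol (odd_level L) s"
proof -
  obtain s1 where "s1 \<in> {0..L}" "odd_quot ((pi / L)\<^sup>2 + L\<^sup>2 / 4 + 1) s1 \<le> 0"
    using odd_quot_has_zero[OF L, of "(pi / L)\<^sup>2 + L\<^sup>2 / 4 + 1"] by auto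
  from odd_level_first_level(2)[OF L this, of s] assms
  show ?thesis by (simp add: hosc_eq_odd_quot)
qed

lemma odd_level_sol_zero [simp]: "odd_sol (odd_level L) L = 0"
proof -
  obtain s1 where "s1 \<in> {0..L}" "odd_quot ((pi / L)\<^sup>2 + L\<^sup>2 / 4 + 1) s1 \<le> 0"
    using odd_quot_has_zero[OF L, of "(pi / L)\<^sup>2 + L\<^sup>2 / 4 + 1"] by auto
  from odd_level_first_level(3)[OF L this] show ?thesis by (simp add: hosc_eq_odd_quot)
qed

text \<open>If the level were below \<open>(pi / L)\<^sup>2\<close>, the Wronskian of
  \<open>sin (pi * s / L)\<close> and the odd solution would increase strictly, the potential being
  nonnegative; but both functions vanish at \<open>0\<close> and at \<open>L\<close>.\<close>

lemma odd_level_ge: "(pi / L)\<^sup>2 \<le> odd_level L"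
proof (rule ccontr)
  assume less: "\<not> ?thesis"
  define E where "E = odd_level L"
  define k where "k = pi / L"
  have k: "k > 0" "k * L = pi" using L by (auto simp: k_def)
  let ?w = "\<lambda>s. sin (k * s) * odd_sol' E s - (k * cos (k * s)) * odd_sol E s"
  have w: "(?w has_real_derivative (s\<^sup>2 / 4 - E - (- k\<^sup>2)) * sin (k * s) * odd_sol E s) (at s)" for s
    by (rule wronskian_has_derivative[OF _ _ odd_sol_DERIV]) 
      (auto intro!: derivative_eq_intros simp: power2_eq_square)
  have "?w 0 < ?w L"
  proof (rule DERIV_pos_imp_increasing_open[OF L])
    fix s assume s: "0 < s" "s < L"
    have "odd_sol E s > 0" using odd_level_sol_pos s by (simp add: E_def)
    moreover have "k * s < pi" using s(2) k mult_strict_left_mono[of s L k] by metis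
    then have "sin (k * s) > 0" using s k by (intro sin_gt_zero) auto
    moreover have "0 < s\<^sup>2" using s by simp
    then have "s\<^sup>2 / 4 - E - (- k\<^sup>2) > 0" using less unfolding k_def E_def by linarith
    ultimately have "(s\<^sup>2 / 4 - E - (- k\<^sup>2)) * sin (k * s) * odd_sol E s > 0"
      by simp
    then show "\<exists>y. DERIV ?w s :> y \<and> y > 0" using w by blast
  next
    show "continuous_on {0..L} ?w"
      by (rule DERIV_continuous_on, rule DERIV_subset[OF w]) auto
  qed
  then show False by (simp add: k E_def)
qed

text \<open>The Wronskian of the two level solutions is \<open>1\<close> at \<open>0\<close> and
  \<open>0\<close> at \<open>L\<close>, where both vanish. With the levels in the opposite order it
  could not decrease.\<close>

lemma even_level_less_odd_level: "even_level L < odd_level L"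
proof (rule ccontr)
  assume le: "\<not> ?thesis"
  let ?C = "even_sol (even_level L)" and ?C' = "even_sol' (even_level L)"
  let ?S = "odd_sol (odd_level L)" and ?S' = "odd_sol' (odd_level L)"
  let ?w = "\<lambda>s. ?C s * ?S' s - ?C' s * ?S s"
  have w: "(?w has_real_derivative (s\<^sup>2 / 4 - odd_level L - (s\<^sup>2 / 4 - even_level L)) * ?C s * ?S s) (at s)" for s
    by (rule wronskian_has_derivative[OF even_sol_DERIV odd_sol_DERIV])
  have "?w 0 \<le> ?w L"
  proof (rule DERIV_nonneg_imp_increasing_open[of 0 L ?w])
    fix s assume s: "0 < s" "s < L"
    then have "?C s > 0" "?S s > 0" using even_level_sol_pos[of s] odd_level_sol_pos[of s] by auto
    then have "(s\<^sup>2 / 4 - odd_level L - (s\<^sup>2 / 4 - even_level L)) * ?C s * ?S s \<ge> 0"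
      using le by simp
    then show "\<exists>y. DERIV ?w s :> y \<and> y \<ge> 0" using w by blast
  next
    show "continuous_on {0..L} ?w"
      by (rule DERIV_continuous_on, rule DERIV_subset[OF w]) auto
  qed (use L in simp)
  then show False by simp
qed

text \<open>A maximum of \<open>h / odd_sol F\<close> at an interior point contradicts \<open>E < F\<close>.\<close>

lemma schrodinger_nonpos_between_zeros:
  assumes "E < F" "F < odd_level L" "0 < a" "a < b" "b \<le> L"
    and h: "\<And>s. (h has_real_derivative h' s) (at s)"
      "\<And>s. (h' has_real_derivative (s\<^sup>2 / 4 - E) * h s) (at s)"
    and "h a = 0" "h b = 0" and s: "s \<in> {a..b}"
  shows "h s \<le> 0"
proof (rule ccontr)
  assume "\<not> ?thesis"
  have S: "0 < odd_sol F t" if "t \<in> {a..b}" for t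
    using odd_sol_pos assms that by auto
  have "continuous_on {a..b} (\<lambda>t. h t / odd_sol F t)"
    using S by (intro continuous_intros odd_sol_cont DERIV_continuous_on[OF DERIV_subset[OF h(1)]]) force+
  then obtain x where x: "x \<in> {a..b}" "\<And>t. t \<in> {a..b} \<Longrightarrow> h t / odd_sol F t \<le> h x / odd_sol F x"
    using continuous_attains_sup[of "{a..b}" "\<lambda>t. h t / odd_sol F t"] \<open>a < b\<close> by auto
  define r where "r = h x / odd_sol F x"
  have "0 < h s / odd_sol F s" using S[OF s] \<open>\<not> h s \<le> 0\<close> by simp
  then have r: "0 < r" using x(2)[OF s] by (simp add: r_def)
  then have "h x > 0" using S[OF x(1)] by (simp add: r_def zero_less_divide_iff)
  then have xab: "a < x" "x < b" using x(1) assms by (auto simp: order_less_le)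
  define d where "d = min (x - a) (b - x)"
  have le: "h t \<le> r * odd_sol F t" if "t \<in> {a..b}" for t
    using x(2)[OF that] S[OF that] by (simp add: r_def field_simps)
  have eq: "h x = r * odd_sol F x" using S[OF x(1)] by (simp add: r_def)
  \<comment> \<open>Near \<open>x\<close> the function \<open>h - r * odd_sol F\<close> is at most
    \<open>0\<close>, with equality at \<open>x\<close>, so the second-derivative test applies to
    it.\<close>
  have "(x\<^sup>2 / 4 - E) * h x - r * ((x\<^sup>2 / 4 - F) * odd_sol F x) \<le> 0"
  proof (rule second_derivative_at_max(2)[where f = "\<lambda>t. h t - r * odd_sol F t" and f' = "\<lambda>t. h' t - r * odd_sol' F t" and d = d and x = x])
    show "h t - r * odd_sol F t \<le> h x - r * odd_sol F x" if "\<bar>t - x\<bar> < d" for t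
      using le[of t] eq that by (simp add: d_def abs_if split: if_splits)
  qed (use xab in \<open>auto simp: d_def intro!: DERIV_diff DERIV_cmult h odd_sol_DERIV\<close>)
  also have "r * ((x\<^sup>2 / 4 - F) * odd_sol F x) = (x\<^sup>2 / 4 - F) * h x" using eq by simp
  finally have "(F - E) * h x \<le> 0" by (simp add: algebra_simps)
  then show False using \<open>E < F\<close> \<open>h x > 0\<close> by (simp add: mult_le_0_iff)
qed

text \<open>Above \<open>even_level L\<close>, Sturm comparison forces a zero \<open>z\<close>
  inside \<open>(0, L)\<close>. Below \<open>odd_level L\<close>, a solution that vanishes at both
  \<open>z\<close> and \<open>L\<close> vanishes in between, which the Wronskian identity
  forbids.\<close>

lemma even_sol_zero_below_odd_level:
  assumes "E < odd_level L" "even_sol E L = 0"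
  shows "E = even_level L"
proof (rule ccontr)
  assume "E \<noteq> even_level L"
  moreover have "\<not> E < even_level L" using even_sol_pos[of E L] assms L by auto
  ultimately have E: "even_level L < E" by simp
  let ?C = "even_sol (even_level L)" and ?C' = "even_sol' (even_level L)"
  have "\<exists>z. 0 < z \<and> z < L \<and> even_sol E z \<le> 0"
  proof (rule ccontr)
    \<comment> \<open>Otherwise the Wronskian with the first level solution would decrease strictly
      although it is \<open>0\<close> at both ends.\<close>
    assume pos: "\<not> ?thesis"
    let ?w = "\<lambda>s. ?C s * even_sol' E s - ?C' s * even_sol E s"
    have w: "(?w has_real_derivative (s\<^sup>2 / 4 - E - (s\<^sup>2 / 4 - even_level L)) * ?C s * even_sol E s) (at s)" for s
      by (rule wronskian_has_derivative[OF even_sol_DERIV even_sol_DERIV])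
    have "?w L < ?w 0"
    proof (rule DERIV_neg_imp_decreasing_open[OF L])
      fix s assume s: "0 < s" "s < L"
      then have "?C s > 0" "even_sol E s > 0" using even_level_sol_pos[of s] pos by (auto simp: not_le)
      then have "(s\<^sup>2 / 4 - E - (s\<^sup>2 / 4 - even_level L)) * ?C s * even_sol E s < 0"
        using E by (simp add: mult_neg_pos)
      then show "\<exists>y. DERIV ?w s :> y \<and> y < 0" using w by blast
    next
      show "continuous_on {0..L} ?w"
        by (rule DERIV_continuous_on, rule DERIV_subset[OF w]) auto
    qed
    then show False using assms(2) by simp
  qed
  then obtain z1 where z1: "0 < z1" "z1 < L" "even_sol E z1 \<le> 0" by blast
  obtain z where z: "0 \<le> z" "z \<le> z1" "even_sol E z = 0"
    using IVT2'[of "even_sol E" z1 0 0] z1 even_sol_cont by auto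
  then have z0: "0 < z" using hosc_0[of 1 0 E] by (cases "z = 0") auto
  \<comment> \<open>With \<open>F\<close> strictly between the two, \<open>odd_sol F\<close> is
    still positive at \<open>L\<close> itself, so that \<open>h / odd_sol F\<close> is defined up to
    the endpoint.\<close>
  obtain F where F: "E < F" "F < odd_level L" using dense[OF assms(1)] by blast
  have zero: "even_sol E s = 0" if "s \<in> {z..L}" for s
  proof (rule antisym)
    show "even_sol E s \<le> 0"
      by (rule schrodinger_nonpos_between_zeros[OF F z0 _ _ even_sol_DERIV, where b = L]) (use z z1 assms(2) that in auto)
    have "- even_sol E s \<le> 0"
      by (rule schrodinger_nonpos_between_zeros[OF F z0, where b = L and h = "\<lambda>s. - even_sol E s" and h' = "\<lambda>s. - even_sol' E s"])
        (use z z1 assms(2) that in \<open>auto intro!: DERIV_cong[OF DERIV_minus] even_sol_DERIV\<close>)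
    then show "0 \<le> even_sol E s" by simp
  qed
  define m where "m = (z + L) / 2"
  have "even_sol' E m = 0"
  proof (rule DERIV_local_max[OF even_sol_DERIV(1)])
    show "0 < (L - z) / 2" using z z1 by simp
    show "\<forall>y. \<bar>m - y\<bar> < (L - z) / 2 \<longrightarrow> even_sol E y \<le> even_sol E m"
    proof (intro allI impI)
      fix y assume "\<bar>m - y\<bar> < (L - z) / 2"
      then have "y \<in> {z..L}" by (auto simp: m_def abs_less_iff field_simps)
      moreover have "m \<in> {z..L}" using z z1 by (simp add: m_def)
      ultimately show "even_sol E y \<le> even_sol E m" using zero by simp
    qed
  qed
  then show False using wronskian_even_odd[of E m] zero[of m] z z1 by (simp add: m_def)
qed

text \<open>Inside, \<open>g\<close> is a combination of the even and the odd solution, and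
  continuity carries this to the endpoints. Adding and subtracting the two boundary conditions
  separates the parts, and \<open>odd_sol E L > 0\<close> removes the odd one.\<close>

lemma dirichlet_interval:
  assumes "continuous_on {-L..L} g"
    and g: "\<And>s. \<bar>s\<bar> < L \<Longrightarrow> (g has_real_derivative g' s) (at s)"
      "\<And>s. \<bar>s\<bar> < L \<Longrightarrow> (g' has_real_derivative (s\<^sup>2 / 4 - E) * g s) (at s)"
    and "g (-L) = 0" "g L = 0" and E: "E < odd_level L"
  shows "g 0 = 0 \<or> E = even_level L" and "s \<in> {-L..L} \<Longrightarrow> g s = g 0 * even_sol E s"
proof -
  define h where "h s = g s - (g 0 * even_sol E s + g' 0 * odd_sol E s)" for s
  have "h s = 0" if "s \<in> {-L<..<L}" for s
    using schrodinger_ivp[of L g g' E s] g that by (simp add: h_def abs_less_iff)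
  moreover have cl: "closure {-L<..<L} = {-L..L}" using L by simp
  moreover have "continuous_on {-L..L} h"
    unfolding h_def by (intro continuous_intros assms even_sol_cont odd_sol_cont)
  ultimately have h: "h s = 0" if "s \<in> {-L..L}" for s
    using continuous_constant_on_closure[of "{-L<..<L}" h 0 s] that by auto
  from h[of L] h[of "-L"] have *: "g 0 * even_sol E L + g' 0 * odd_sol E L = 0"
    "g 0 * even_sol E L - g' 0 * odd_sol E L = 0"
    using L assms by (auto simp: h_def)
  then have "g' 0 * odd_sol E L = 0" "g 0 * even_sol E L = 0" by auto
  moreover have "odd_sol E L > 0" using odd_sol_pos[OF E] L by simp
  ultimately have "g' 0 = 0" "g 0 = 0 \<or> even_sol E L = 0" by auto
  then show "g 0 = 0 \<or> E = even_level L" using even_sol_zero_below_odd_level[OF E] by auto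
  show "g s = g 0 * even_sol E s" if "s \<in> {-L..L}" 
    using h[OF that] \<open>g' 0 = 0\<close> by (simp add: h_def)
qed

end

section \<open>The Ornstein-Uhlenbeck eigenvalues\<close>

text \<open>Multiplication by \<open>exp (s\<^sup>2 / 4)\<close> turns the oscillator equation at
  energy \<open>E\<close> into the Ornstein-Uhlenbeck equation at \<open>E - 1/2\<close>.\<close>

lemma OU_eigenvalueI:
  assumes "0 < D" "\<bar>c\<bar> \<le> 1" "\<bar>d\<bar> \<le> 1" "c \<noteq> 0 \<or> d \<noteq> 0"
    and "hosc c d E (D/2) = 0" "hosc c d E (- (D/2)) = 0"
  shows "OU_eigenvalue D (E - 1/2)"
proof -
  let ?g = "hosc c d E" and ?g' = "hosc' c d E"
  define e where "e s = exp (s\<^sup>2 / 4)" for s :: real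
  have e: "(e has_real_derivative s / 2 * e s) (at s)" for s
    unfolding e_def by (auto intro!: derivative_eq_intros)
  note g = hosc_has_derivative[OF assms(2,3)]
  have 1: "((\<lambda>s. e s * ?g s) has_real_derivative e s * (?g' s + s / 2 * ?g s)) (at s)" for s
    by (rule DERIV_cong[OF DERIV_mult[OF e g(1)]]) (simp add: algebra_simps)
  have "((\<lambda>s. ?g' s + s / 2 * ?g s) has_real_derivative
      (s\<^sup>2 / 4 - E) * ?g s + (1 / 2 * ?g s + ?g' s * (s / 2))) (at s)" for s
    by (rule DERIV_add[OF g(2) DERIV_mult[OF _ g(1)]]) (auto intro!: derivative_eq_intros)
  note 2 = DERIV_mult[OF e this]
  have "\<exists>s\<in>{-D/2<..<D/2}. ?g s \<noteq> 0"
  proof (cases "c = 0")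
    case False
    then show ?thesis using assms(1) by (intro bexI[of _ 0]) auto
  next
    case True
    \<comment> \<open>Vanishing on the whole interval would make \<open>0\<close> a local maximum,
      so the slope \<open>d\<close> at \<open>0\<close> would be zero.\<close>
    have "?g' 0 = 0" if "\<forall>s\<in>{-D/2<..<D/2}. ?g s = 0"
    proof (rule DERIV_local_max[OF g(1), of "D/2"])
      show "\<forall>y. \<bar>0 - y\<bar> < D/2 \<longrightarrow> ?g y \<le> ?g 0"
      proof (intro allI impI)
        fix y assume "\<bar>0 - y\<bar> < D/2"
        then have "y \<in> {-D/2<..<D/2}" by (auto simp: abs_less_iff)
        then have "?g y = 0" using that by blast
        then show "?g y \<le> ?g 0" using True by simp
      qed
    qed (use assms(1) in simp)
    then show ?thesis using assms(4) True by auto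
  qed
  moreover have "continuous_on {-D/2..D/2} (\<lambda>s. e s * ?g s)"
    by (rule DERIV_continuous_on, rule DERIV_subset[OF 1]) auto
  moreover have "- (s / 2 * e s * (?g' s + s / 2 * ?g s) + ((s\<^sup>2 / 4 - E) * ?g s + (1 / 2 * ?g s + ?g' s * (s / 2))) * e s)
      + s * (e s * (?g' s + s / 2 * ?g s)) = (E - 1/2) * (e s * ?g s)" for s
    by (simp add: field_simps power2_eq_square)
  moreover have "e s \<noteq> 0" for s by (simp add: e_def)
  moreover have "?g (-D/2) = 0" using assms(6) by simp
  ultimately show ?thesis
    unfolding OU_eigenvalue_def using assms(5)
    by (intro exI[of _ "\<lambda>s. e s * ?g s"] exI[of _ "\<lambda>s. e s * (?g' s + s / 2 * ?g s)"]
        exI[of _ "\<lambda>s. s / 2 * e s * (?g' s + s / 2 * ?g s) + ((s\<^sup>2 / 4 - E) * ?g s + (1 / 2 * ?g s + ?g' s * (s / 2))) * e s"]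
        conjI ballI 1 2) (simp_all only: mult_eq_0_iff simp_thms)
qed

text \<open>The factor \<open>exp (- s\<^sup>2 / 4)\<close> undoes the gauge, and
  \<open>dirichlet_interval\<close> applies at energy \<open>lam + 1/2\<close>.\<close>

lemma OU_eigenvalue_below_odd_level:
  assumes "0 < D" "OU_eigenvalue D lam" "lam + 1/2 < odd_level (D/2)"
  shows "lam + 1/2 = even_level (D/2)"
proof -
  obtain u u' u'' where cont: "continuous_on {-D/2..D/2} u"
    and u: "\<And>s. s \<in> {-D/2<..<D/2} \<Longrightarrow> (u has_real_derivative u' s) (at s)"
      "\<And>s. s \<in> {-D/2<..<D/2} \<Longrightarrow> (u' has_real_derivative u'' s) (at s)"
      "\<And>s. s \<in> {-D/2<..<D/2} \<Longrightarrow> - u'' s + s * u' s = lam * u s"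
    and zero: "u (-D/2) = 0" "u (D/2) = 0" and ne: "\<exists>s\<in>{-D/2<..<D/2}. u s \<noteq> 0"
    using assms(2) unfolding OU_eigenvalue_def by blast
  define e where "e s = exp (- s\<^sup>2 / 4)" for s :: real
  have e: "(e has_real_derivative - s / 2 * e s) (at s)" for s
    unfolding e_def by (auto intro!: derivative_eq_intros)
  define g where "g s = e s * u s" for s
  define g' where "g' s = e s * (u' s - s / 2 * u s)" for s
  have I: "s \<in> {-D/2<..<D/2}" if "\<bar>s\<bar> < D/2" for s using that by (auto simp: abs_less_iff)
  have g: "(g has_real_derivative g' s) (at s)" if "\<bar>s\<bar> < D/2" for s
    unfolding g_def g'_def
    by (rule DERIV_cong[OF DERIV_mult[OF e u(1)[OF I[OF that]]]]) (simp add: algebra_simps)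
  have g': "(g' has_real_derivative (s\<^sup>2 / 4 - (lam + 1/2)) * g s) (at s)" if "\<bar>s\<bar> < D/2" for s
  proof -
    have "((\<lambda>s. u' s - s / 2 * u s) has_real_derivative (u'' s - (1 / 2 * u s + u' s * (s / 2)))) (at s)"
      by (rule DERIV_diff[OF u(2)[OF I[OF that]] DERIV_mult[OF _ u(1)[OF I[OF that]]]])
        (auto intro!: derivative_eq_intros)
    note * = DERIV_mult[OF e this]
    have eq: "u'' s = s * u' s - lam * u s" using u(3)[OF I[OF that]] by simp
    show ?thesis unfolding g'_def g_def
      by (rule DERIV_cong[OF *], unfold eq) (simp add: field_simps power2_eq_square)
  qed
  have c: "continuous_on {- (D/2)..D/2} g"
    unfolding g_def e_def using cont by (auto intro!: continuous_intros)
  have z: "g (- (D/2)) = 0" "g (D/2) = 0" using zero by (auto simp: g_def)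
  have "0 < D/2" using assms by simp
  note * = dirichlet_interval[OF this c g g' z assms(3)]
  obtain s where s: "s \<in> {-D/2<..<D/2}" "g s \<noteq> 0" using ne by (auto simp: g_def e_def)
  then have "g 0 \<noteq> 0" using *(2)[of s] by auto
  then show ?thesis using *(1) by auto
qed

lemma OU_eigval_eq_levels:
  assumes "0 < D"
  shows "OU_eigval D 1 = even_level (D/2) - 1/2" and "OU_eigval D 2 = odd_level (D/2) - 1/2"
proof -
  have D: "0 < D/2" using assms by simp
  define m1 where "m1 = even_level (D/2) - 1/2"
  define m2 where "m2 = odd_level (D/2) - 1/2"
  have lt: "m1 < m2" using even_level_less_odd_level[OF D] by (simp add: m1_def m2_def)
  have e1: "OU_eigenvalue D m1"
    unfolding m1_def by (rule OU_eigenvalueI[where c = 1 and d = 0]) (use assms D in simp_all)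
  have e2: "OU_eigenvalue D m2"
    unfolding m2_def by (rule OU_eigenvalueI[where c = 0 and d = 1]) (use assms D in simp_all)
  have below: "lam = m1" if "OU_eigenvalue D lam" "lam < m2" for lam
    using OU_eigenvalue_below_odd_level[OF assms that(1)] that(2) by (simp add: m1_def m2_def)
  show "OU_eigval D 1 = m1"
    unfolding OU_eigval_def
  proof (rule Least_equality)
    show "\<exists>F. finite F \<and> F \<subseteq> {lam. OU_eigenvalue D lam} \<inter> {..m1} \<and> card F = 1"
      using e1 by (intro exI[of _ "{m1}"]) auto
  next
    fix \<mu> assume "\<exists>F. finite F \<and> F \<subseteq> {lam. OU_eigenvalue D lam} \<inter> {..\<mu>} \<and> card F = 1"
    then obtain lam where "OU_eigenvalue D lam" "lam \<le> \<mu>" by (auto simp: card_1_singleton_iff)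
    then show "m1 \<le> \<mu>" using below[of lam] lt by (cases "lam < m2") auto
  qed
  show "OU_eigval D 2 = m2"
    unfolding OU_eigval_def
  proof (rule Least_equality)
    show "\<exists>F. finite F \<and> F \<subseteq> {lam. OU_eigenvalue D lam} \<inter> {..m2} \<and> card F = 2"
      using e1 e2 lt by (intro exI[of _ "{m1, m2}"]) auto
  next
    fix \<mu> assume "\<exists>F. finite F \<and> F \<subseteq> {lam. OU_eigenvalue D lam} \<inter> {..\<mu>} \<and> card F = 2"
    then obtain F where F: "F \<subseteq> {lam. OU_eigenvalue D lam} \<inter> {..\<mu>}" "card F = 2" by blast
    show "m2 \<le> \<mu>"
    proof (rule ccontr)
      assume "\<not> m2 \<le> \<mu>"
      then have "F \<subseteq> {m1}" using F(1) below by force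
      then have "card F \<le> card {m1}" by (intro card_mono) auto
      then show False using F(2) by simp
    qed
  qed
qed

section \<open>Second derivatives of limits\<close>

lemma convex_concave_imp_interpolates:
  fixes d :: "real \<Rightarrow> real"
  assumes "convex_on {p..q} d" "convex_on {p..q} (\<lambda>x. - d x)" "p < q" "z \<in> {p..q}"
  shows "d z = d p + (z - p) * ((d q - d p) / (q - p))"
proof -
  define t where "t = (z - p) / (q - p)"
  have t: "0 \<le> t" "t \<le> 1" using assms by (auto simp: t_def)
  have "(1 - t) * p + t * q = p + t * (q - p)" by (simp add: algebra_simps)
  also have "\<dots> = z" using \<open>p < q\<close> by (simp add: t_def)
  finally have z: "(1 - t) * p + t * q = z" .
  have "d z = (1 - t) * d p + t * d q"
    using convex_onD[OF assms(1) t, of p q] convex_onD[OF assms(2) t, of p q] z \<open>p < q\<close> by simp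
  also have "\<dots> = d p + t * (d q - d p)" by (simp add: algebra_simps)
  finally show ?thesis by (simp add: t_def)
qed

text \<open>Adding \<open>e * w\<^sup>2 / 2\<close> makes \<open>f n\<close> convex for large
  \<open>n\<close>. The convexity inequality passes to the limit in \<open>n\<close>, and then
  \<open>e\<close> is sent to \<open>0\<close>.\<close>

lemma convex_on_limit_second_derivative:
  fixes f :: "nat \<Rightarrow> real \<Rightarrow> real"
  assumes "convex A" 
    and f1: "\<And>n y. y \<in> A \<Longrightarrow> (f n has_real_derivative f1 n y) (at y)"
    and f2: "\<And>n y. y \<in> A \<Longrightarrow> (f1 n has_real_derivative f2 n y) (at y)"
    and lim: "\<And>y. y \<in> A \<Longrightarrow> (\<lambda>n. f n y) \<longlonglongrightarrow> g y"
    and nonneg: "\<And>e. 0 < e \<Longrightarrow> \<forall>\<^sub>F n in sequentially. \<forall>y\<in>A. - e \<le> f2 n y"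
  shows "convex_on A g"
proof (rule convex_onI)
  fix t x y :: real assume t: "0 < t" "t < 1" and xy: "x \<in> A" "y \<in> A"
  define z where "z = (1 - t) *\<^sub>R x + t *\<^sub>R y"
  have z: "z \<in> A" unfolding z_def by (rule convexD_alt[OF assms(1)]) (use t xy in auto)
  \<comment> \<open>\<open>e * K\<close> bounds what the added parabola contributes to the convexity
    inequality.\<close>
  define K where "K = \<bar>(1 - t) * x\<^sup>2 + t * y\<^sup>2 - z\<^sup>2\<bar> / 2"
  have K: "g z \<le> (1 - t) * g x + t * g y + e * K" if e: "0 < e" for e
  proof (rule LIMSEQ_le)
    show "(\<lambda>n. f n z) \<longlonglongrightarrow> g z" by (rule lim[OF z])
    show "(\<lambda>n. (1 - t) * f n x + t * f n y + e * K) \<longlonglongrightarrow> (1 - t) * g x + t * g y + e * K"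
      by (intro tendsto_intros lim xy)
    obtain N where N: "\<And>n w. N \<le> n \<Longrightarrow> w \<in> A \<Longrightarrow> - e \<le> f2 n w"
      using nonneg[OF e] unfolding eventually_sequentially by blast
    show "\<exists>N. \<forall>n\<ge>N. f n z \<le> (1 - t) * f n x + t * f n y + e * K"
    proof (intro exI allI impI)
      fix n assume "N \<le> n"
      have "convex_on A (\<lambda>w. f n w + e * w\<^sup>2 / 2)"
      proof (rule f''_ge0_imp_convex[OF assms(1)])
        show "((\<lambda>w. f n w + e * w\<^sup>2 / 2) has_real_derivative f1 n w + e * w) (at w)" if "w \<in> A" for w
          using f1[OF that] by (auto intro!: derivative_eq_intros)
        show "((\<lambda>w. f1 n w + e * w) has_real_derivative f2 n w + e) (at w)" if "w \<in> A" for w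
          using f2[OF that] by (auto intro!: derivative_eq_intros)
        show "0 \<le> f2 n w + e" if "w \<in> A" for w using N[OF \<open>N \<le> n\<close> that] by simp
      qed
      from convex_onD[OF this, of t x y] t xy
      have "f n z + e * z\<^sup>2 / 2 \<le> (1 - t) * (f n x + e * x\<^sup>2 / 2) + t * (f n y + e * y\<^sup>2 / 2)"
        by (simp add: z_def)
      then have "f n z \<le> (1 - t) * f n x + t * f n y + e * (((1 - t) * x\<^sup>2 + t * y\<^sup>2 - z\<^sup>2) / 2)"
        by (simp add: field_simps)
      also have "\<dots> \<le> (1 - t) * f n x + t * f n y + e * K"
        unfolding K_def using \<open>0 < e\<close>
        by (intro add_left_mono mult_left_mono divide_right_mono abs_ge_self) auto
      finally show "f n z \<le> (1 - t) * f n x + t * f n y + e * K" .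
    qed
  qed
  have "g z \<le> (1 - t) * g x + t * g y + e" if "0 < e" for e
  proof -
    have "0 \<le> K" by (simp add: K_def)
    \<comment> \<open>\<open>K\<close> is \<open>0\<close> when \<open>x = y\<close>, hence the
      denominator \<open>K + 1\<close>.\<close>
    have "g z \<le> (1 - t) * g x + t * g y + e / (K + 1) * K"
      using K[of "e / (K + 1)"] that \<open>0 \<le> K\<close> by simp
    also have "e / (K + 1) * K \<le> e" using that \<open>0 \<le> K\<close> by (simp add: field_simps)
    finally show ?thesis by simp
  qed
  then show "g z \<le> (1 - t) * g x + t * g y" by (rule field_le_epsilon)
qed (rule assms)

text \<open>
  With \<open>H'' = h\<close>, the limit of \<open>f n - H\<close> is both convex and concave, hence affine; so no
  convergence of first derivatives is needed.
\<close>

lemma second_derivative_limit: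
  fixes f :: "nat \<Rightarrow> real \<Rightarrow> real"
  assumes pq: "p < q"
    and f1: "\<And>n y. y \<in> {p..q} \<Longrightarrow> (f n has_real_derivative f1 n y) (at y)"
    and f2: "\<And>n y. y \<in> {p..q} \<Longrightarrow> (f1 n has_real_derivative f2 n y) (at y)"
    and lim: "\<And>y. y \<in> {p..q} \<Longrightarrow> (\<lambda>n. f n y) \<longlonglongrightarrow> g y"
    and unif: "uniform_limit {p..q} f2 h sequentially"
    and h: "continuous_on {p'..q'} h" "p' < p" "q < q'"
    and y: "y \<in> {p<..<q}"
  shows "(g has_real_derivative deriv g y) (at y)" "(deriv g has_real_derivative h y) (at y)"
proof -
  \<comment> \<open>Starting at \<open>p' < p\<close>, and with \<open>q < q'\<close>, the integrals
    have two-sided derivatives at every point of \<open>[p, q]\<close>, endpoints included.\<close>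
  define H1 where "H1 y = integral {p'..y} h" for y
  define H where "H y = integral {p'..y} H1" for y
  have H1: "(H1 has_real_derivative h y) (at y)" if "y \<in> {p..q}" for y
  proof -
    have "(H1 has_real_derivative h y) (at y within {p'..q'})"
      unfolding H1_def by (rule integral_has_real_derivative[OF h(1)]) (use that h(2,3) in auto)
    moreover have "at y within {p'..q'} = at y" using that h(2,3) by (intro at_within_Icc_at) auto
    ultimately show ?thesis by (rule subst[of _ _ "\<lambda>F. (_ has_real_derivative _) F", rotated])
  qed
  have c: "continuous_on {p'..q'} H1"
    unfolding H1_def by (rule DERIV_continuous_on, rule integral_has_real_derivative[OF h(1)])
  have H: "(H has_real_derivative H1 y) (at y)" if "y \<in> {p..q}" for y
  proof -
    have "(H has_real_derivative H1 y) (at y within {p'..q'})"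
      unfolding H_def by (rule integral_has_real_derivative[OF c]) (use that h(2,3) in auto)
    moreover have "at y within {p'..q'} = at y" using that h(2,3) by (intro at_within_Icc_at) auto
    ultimately show ?thesis by (rule subst[of _ _ "\<lambda>F. (_ has_real_derivative _) F", rotated])
  qed
  define d where "d y = g y - H y" for y
  have ev: "\<forall>\<^sub>F n in sequentially. \<forall>y\<in>{p..q}. \<bar>f2 n y - h y\<bar> < e" if "0 < e" for e
    using uniform_limitD[OF unif that] by (simp add: dist_real_def)
  have cv: "convex_on {p..q} d" unfolding d_def
  proof (rule convex_on_limit_second_derivative[where f = "\<lambda>n y. f n y - H y" and ?f1.0 = "\<lambda>n y. f1 n y - H1 y"
        and ?f2.0 = "\<lambda>n y. f2 n y - h y"])
    show "\<forall>\<^sub>F n in sequentially. \<forall>y\<in>{p..q}. - e \<le> f2 n y - h y" if "0 < e" for e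
      using ev[OF that] by (rule eventually_mono) (force simp: abs_less_iff)
  qed (rule convex_real_interval DERIV_diff f1 f2 H H1 tendsto_diff lim tendsto_const | assumption)+
  have cc: "convex_on {p..q} (\<lambda>y. - d y)" unfolding d_def
  proof (rule convex_on_limit_second_derivative[where f = "\<lambda>n y. - (f n y - H y)" and ?f1.0 = "\<lambda>n y. - (f1 n y - H1 y)"
        and ?f2.0 = "\<lambda>n y. - (f2 n y - h y)"])
    show "\<forall>\<^sub>F n in sequentially. \<forall>y\<in>{p..q}. - e \<le> - (f2 n y - h y)" if "0 < e" for e
      using ev[OF that] by (rule eventually_mono) (force simp: abs_less_iff)
  qed (rule convex_real_interval DERIV_minus DERIV_diff f1 f2 H H1 tendsto_minus tendsto_diff lim tendsto_const | assumption)+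
  define s where "s = (d q - d p) / (q - p)"
  have d: "d z = d p + (z - p) * s" if "z \<in> {p..q}" for z
    unfolding s_def by (rule convex_concave_imp_interpolates[OF cv cc pq that])
  have g: "(g has_real_derivative H1 z + s) (at z)" if "z \<in> {p<..<q}" for z
  proof -
    have "((\<lambda>z. H z + (d p + (z - p) * s)) has_real_derivative H1 z + s) (at z)"
      using H[of z] that by (auto intro!: derivative_eq_intros)
    then show ?thesis
    proof (rule has_field_derivative_transform_within_open[where S = "{p<..<q}"])
      show "H w + (d p + (w - p) * s) = g w" if "w \<in> {p<..<q}" for w
        using d[of w] that by (simp add: d_def)
    qed (use that in auto)
  qed
  then have dg: "deriv g z = H1 z + s" if "z \<in> {p<..<q}" for z
    using that by (intro DERIV_imp_deriv) auto
  show "(g has_real_derivative deriv g y) (at y)" using g[OF y] dg[OF y] by simp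
  have "((\<lambda>z. H1 z + s) has_real_derivative h y) (at y)"
    using H1[of y] y by (auto intro!: derivative_eq_intros)
  then show "(deriv g has_real_derivative h y) (at y)"
    by (rule has_field_derivative_transform_within_open[where S = "{p<..<q}"]) (use y dg in auto)
qed

section \<open>Solutions on a rectangle\<close>

text \<open>\<open>\<Lambda>\<close> stands for \<open>lam + 1\<close>. The derivatives are
  parameters, so that reflections and linear combinations are again instances; they are controlled
  only in the open rectangle, while \<open>v\<close> is continuous up to the boundary.\<close>

locale rect_sol =
  fixes L M \<Lambda> :: real and v vx vxx vy vyy :: "real \<Rightarrow> real \<Rightarrow> real"
  assumes L: "0 < L" and M: "0 < M"
    and v_cont: "continuous_on ({-L..L} \<times> {-M..M}) (\<lambda>(x, y). v x y)"
    and vx_cont: "continuous_on ({-L<..<L} \<times> {-M<..<M}) (\<lambda>(x, y). vx x y)"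
    and vxx_cont: "continuous_on ({-L<..<L} \<times> {-M<..<M}) (\<lambda>(x, y). vxx x y)"
    and vy_cont: "continuous_on ({-L<..<L} \<times> {-M<..<M}) (\<lambda>(x, y). vy x y)"
    and vyy_cont: "continuous_on ({-L<..<L} \<times> {-M<..<M}) (\<lambda>(x, y). vyy x y)"
    and vx: "\<bar>x\<bar> < L \<Longrightarrow> \<bar>y\<bar> < M \<Longrightarrow> ((\<lambda>x. v x y) has_real_derivative vx x y) (at x)"
    and vxx: "\<bar>x\<bar> < L \<Longrightarrow> \<bar>y\<bar> < M \<Longrightarrow> ((\<lambda>x. vx x y) has_real_derivative vxx x y) (at x)"
    and vy: "\<bar>x\<bar> < L \<Longrightarrow> \<bar>y\<bar> < M \<Longrightarrow> ((\<lambda>y. v x y) has_real_derivative vy x y) (at y)"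
    and vyy: "\<bar>x\<bar> < L \<Longrightarrow> \<bar>y\<bar> < M \<Longrightarrow> ((\<lambda>y. vy x y) has_real_derivative vyy x y) (at y)"
    and eq: "\<bar>x\<bar> < L \<Longrightarrow> \<bar>y\<bar> < M \<Longrightarrow> vxx x y + vyy x y = ((x\<^sup>2 + y\<^sup>2) / 4 - \<Lambda>) * v x y"
    and zero: "\<bar>x\<bar> \<le> L \<Longrightarrow> \<bar>y\<bar> \<le> M \<Longrightarrow> \<bar>x\<bar> = L \<or> \<bar>y\<bar> = M \<Longrightarrow> v x y = 0"
begin

section \<open>The partial moment \<open>P\<close> and its derivatives\<close>

abbreviation "\<phi> \<equiv> even_sol (even_level L)"
abbreviation "\<phi>' \<equiv> even_sol' (even_level L)"

definition P :: "real \<Rightarrow> real \<Rightarrow> real" where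
  "P x y = integral {-L..x} (\<lambda>t. v t y * \<phi> t)"

lemma cont_slice_x:
  assumes "\<bar>y\<bar> \<le> M"
  shows "continuous_on {-L..L} (\<lambda>t. v t y)"
proof -
  have "continuous_on {-L..L} (\<lambda>t. (\<lambda>(x, y). v x y) (t, y))"
    by (rule continuous_on_compose2[OF v_cont]) (use assms in \<open>auto intro!: continuous_intros\<close>)
  then show ?thesis by simp
qed

lemma cont_slice_y:
  assumes "\<bar>x\<bar> \<le> L"
  shows "continuous_on {-M..M} (\<lambda>t. v x t)"
proof -
  have "continuous_on {-M..M} (\<lambda>t. (\<lambda>(x, y). v x y) (x, t))"
    by (rule continuous_on_compose2[OF v_cont]) (use assms in \<open>auto intro!: continuous_intros\<close>)
  then show ?thesis by simp
qed

lemma v_bounded: "\<exists>B>0. \<forall>x y. \<bar>x\<bar> \<le> L \<longrightarrow> \<bar>y\<bar> \<le> M \<longrightarrow> \<bar>v x y\<bar> \<le> B"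
proof -
  have "compact ((\<lambda>(x, y). v x y) ` ({-L..L} \<times> {-M..M}))"
    by (intro compact_continuous_image v_cont compact_Times) auto
  from compact_imp_bounded[OF this] obtain B where "B > 0"
    "\<forall>z\<in>(\<lambda>(x, y). v x y) ` ({-L..L} \<times> {-M..M}). norm z \<le> B" 
    unfolding bounded_pos by blast
  then show ?thesis by (intro exI[of _ B]) (auto simp: abs_le_iff)
qed

lemma P_has_derivative_x:
  assumes "\<bar>x\<bar> < L" "\<bar>y\<bar> \<le> M"
  shows "((\<lambda>x. P x y) has_real_derivative v x y * \<phi> x) (at x)"
proof -
  have "((\<lambda>x. P x y) has_real_derivative v x y * \<phi> x) (at x within {-L..L})"
    unfolding P_def using assms
    by (intro integral_has_real_derivative continuous_intros cont_slice_x even_sol_cont) auto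
  moreover have "at x within {-L..L} = at x"
    using assms by (intro at_within_Icc_at) auto
  ultimately show ?thesis by simp
qed

text \<open>Writing the integral over a fixed interval makes joint continuity immediate.\<close>

lemma P_cont: "continuous_on ({-L..L} \<times> {-M..M}) (\<lambda>(x, y). P x y)"
proof -
  define w where "w y t = v t y * \<phi> t" for y t
  have w: "continuous_on {-L..L} (w y)" if "\<bar>y\<bar> \<le> M" for y
    unfolding w_def by (intro continuous_intros cont_slice_x even_sol_cont that)
  \<comment> \<open>Freezing the integrand at \<open>t = x\<close> beyond \<open>x\<close> adds
    \<open>(L - x) * w y x\<close> to the integral over \<open>[-L, x]\<close>.\<close>
  have eq: "P x y = integral {-L..L} (\<lambda>t. w y (min t x)) - (L - x) * w y x"
    if "x \<in> {-L..L}" "y \<in> {-M..M}" for x y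
  proof -
    have y: "\<bar>y\<bar> \<le> M" using that by auto
    have "continuous_on {-L..L} (\<lambda>t. w y (min t x))"
      by (rule continuous_on_compose2[OF w[OF y]]) (use that in \<open>auto intro!: continuous_intros\<close>)
    then have "integral {-L..L} (\<lambda>t. w y (min t x)) 
        = integral {-L..x} (\<lambda>t. w y (min t x)) + integral {x..L} (\<lambda>t. w y (min t x))"
      using that by (intro Henstock_Kurzweil_Integration.integral_combine[symmetric] integrable_continuous_interval) auto
    also have "integral {-L..x} (\<lambda>t. w y (min t x)) = integral {-L..x} (w y)"
      by (rule integral_cong) (auto simp: min_def)
    also have "integral {x..L} (\<lambda>t. w y (min t x)) = integral {x..L} (\<lambda>t. w y x)"
      by (rule integral_cong) (auto simp: min_def)
    also have "\<dots> = (L - x) * w y x" using that by simp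
    finally show ?thesis by (simp add: P_def w_def)
  qed
  have wc: "continuous_on ({-L..L} \<times> {-M..M}) (\<lambda>(x, y). w y x)"
    unfolding w_def case_prod_beta
    by (intro continuous_intros continuous_on_compose2[OF even_sol_cont(1)[of UNIV]]
        v_cont[unfolded case_prod_beta]) auto
  have "continuous_on ({-L..L} \<times> {-M..M}) (\<lambda>p. integral (cbox (-L) L) (\<lambda>t. w (snd p) (min t (fst p))))"
  proof (rule integral_continuous_on_param)
    have "continuous_on (({-L..L} \<times> {-M..M}) \<times> cbox (-L) L) 
       (\<lambda>q. (\<lambda>(x, y). w y x) (min (snd q) (fst (fst q)), snd (fst q)))"
      by (rule continuous_on_compose2[OF wc], intro continuous_intros) (auto simp: min_def)
    then show "continuous_on (({-L..L} \<times> {-M..M}) \<times> cbox (-L) L) (\<lambda>(p, t). w (snd p) (min t (fst p)))"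
      by (simp add: case_prod_beta)
  qed
  then have "continuous_on ({-L..L} \<times> {-M..M}) (\<lambda>p. integral {-L..L} (\<lambda>t. w (snd p) (min t (fst p)))
      - (L - fst p) * w (snd p) (fst p))"
    using wc by (auto intro!: continuous_intros simp: case_prod_beta)
  then show ?thesis
    by (rule continuous_on_eq) (use eq in auto)
qed

text \<open>The equation expresses \<open>vyy\<close> through \<open>v\<close> and
  \<open>vxx\<close>, and \<open>vxx\<close> is integrated twice by parts against
  \<open>\<phi> - c\<close>. The constant \<open>c\<close> is there so that the choice
  \<open>c = \<phi> a\<close> removes \<open>vx a y\<close>, which is not controlled as
  \<open>a\<close> approaches \<open>-L\<close>.\<close>

lemma integral_yy_by_parts:
  assumes ab: "-L < a" "a \<le> b" "b < L" and y: "\<bar>y\<bar> < M"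
  shows "integral {a..b} (\<lambda>t. vyy t y * (\<phi> t - c))
    = (y\<^sup>2 / 4 + even_level L - \<Lambda>) * integral {a..b} (\<lambda>t. v t y * \<phi> t)
      - c * integral {a..b} (\<lambda>t. ((t\<^sup>2 + y\<^sup>2) / 4 - \<Lambda>) * v t y)
      - (vx b y * (\<phi> b - c) - v b y * \<phi>' b) + (vx a y * (\<phi> a - c) - v a y * \<phi>' a)"
proof -
  let ?K = "y\<^sup>2 / 4 + even_level L - \<Lambda>"
  \<comment> \<open>In the derivative of \<open>w\<close> the products
    \<open>vx t y * \<phi>' t\<close> cancel, leaving \<open>vxx\<close> and the second derivative
    of \<open>\<phi>\<close>.\<close>
  define w where "w t = vx t y * (\<phi> t - c) - v t y * \<phi>' t" for t
  have sub: "t \<in> {a..b} \<Longrightarrow> \<bar>t\<bar> < L" for t using ab by auto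
  have cv: "continuous_on {a..b} (\<lambda>t. v t y)"
    by (rule continuous_on_subset[OF cont_slice_x]) (use ab y in auto)
  have w: "(w has_real_derivative vxx t y * (\<phi> t - c) - (t\<^sup>2 / 4 - even_level L) * v t y * \<phi> t) (at t)"
    if "t \<in> {a..b}" for t
    unfolding w_def
    by (rule DERIV_cong[OF DERIV_diff[OF DERIV_mult[OF vxx[OF sub[OF that] y] 
          DERIV_diff[OF even_sol_DERIV(1) DERIV_const]] DERIV_mult[OF vx[OF sub[OF that] y] even_sol_DERIV(2)]]])
      (simp add: algebra_simps)
  have A: "((\<lambda>t. vxx t y * (\<phi> t - c) - (t\<^sup>2 / 4 - even_level L) * v t y * \<phi> t) has_integral w b - w a) {a..b}"
    by (rule fundamental_theorem_of_calculus[OF ab(2)])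
      (use w in \<open>auto simp: has_real_derivative_iff_has_vector_derivative intro: has_vector_derivative_at_within\<close>)
  have B: "((\<lambda>t. ?K * (v t y * \<phi> t)) has_integral ?K * integral {a..b} (\<lambda>t. v t y * \<phi> t)) {a..b}"
    by (intro has_integral_mult_right integrable_integral integrable_continuous_interval continuous_intros cv even_sol_cont)
  have C: "((\<lambda>t. c * (((t\<^sup>2 + y\<^sup>2) / 4 - \<Lambda>) * v t y)) has_integral 
      c * integral {a..b} (\<lambda>t. ((t\<^sup>2 + y\<^sup>2) / 4 - \<Lambda>) * v t y)) {a..b}"
    by (intro has_integral_mult_right integrable_integral integrable_continuous_interval continuous_intros cv) auto
  from has_integral_diff[OF has_integral_diff[OF B C] A]
  have "((\<lambda>t. ?K * (v t y * \<phi> t) - c * (((t\<^sup>2 + y\<^sup>2) / 4 - \<Lambda>) * v t y)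
      - (vxx t y * (\<phi> t - c) - (t\<^sup>2 / 4 - even_level L) * v t y * \<phi> t)) has_integral
      ?K * integral {a..b} (\<lambda>t. v t y * \<phi> t) - c * integral {a..b} (\<lambda>t. ((t\<^sup>2 + y\<^sup>2) / 4 - \<Lambda>) * v t y) - (w b - w a)) {a..b}" .
  then have "((\<lambda>t. vyy t y * (\<phi> t - c)) has_integral 
      ?K * integral {a..b} (\<lambda>t. v t y * \<phi> t) - c * integral {a..b} (\<lambda>t. ((t\<^sup>2 + y\<^sup>2) / 4 - \<Lambda>) * v t y) - (w b - w a)) {a..b}"
  proof (rule has_integral_eq[rotated])
    fix t assume "t \<in> {a..b}"
    have vyy_eq: "vyy t y = ((t\<^sup>2 + y\<^sup>2) / 4 - \<Lambda>) * v t y - vxx t y"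
      using eq[OF sub[OF \<open>t \<in> {a..b}\<close>] y] by simp
    show "?K * (v t y * \<phi> t) - c * (((t\<^sup>2 + y\<^sup>2) / 4 - \<Lambda>) * v t y)
      - (vxx t y * (\<phi> t - c) - (t\<^sup>2 / 4 - even_level L) * v t y * \<phi> t) = vyy t y * (\<phi> t - c)"
      unfolding vyy_eq by (simp add: field_simps)
  qed
  then show ?thesis by (simp add: integral_unique w_def)
qed

text \<open>On a compact interval strictly inside \<open>(-L, L)\<close> the
  \<open>y\<close>-derivatives are jointly continuous, so differentiation under the integral is
  legitimate.\<close>

lemma truncated_has_derivative_y:
  assumes ab: "-L < a" "a \<le> b" "b < L" and y: "\<bar>y\<bar> < M"
  shows "((\<lambda>y. integral {a..b} (\<lambda>t. v t y * (\<phi> t - c))) has_real_derivative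
      integral {a..b} (\<lambda>t. vy t y * (\<phi> t - c))) (at y)"
    and "((\<lambda>y. integral {a..b} (\<lambda>t. vy t y * (\<phi> t - c))) has_real_derivative
      integral {a..b} (\<lambda>t. vyy t y * (\<phi> t - c))) (at y)"
proof -
  let ?U = "{-M<..<M}"
  have at: "at y within ?U = at y" using y by (intro at_within_open) auto
  have sub: "t \<in> {a..b} \<Longrightarrow> \<bar>t\<bar> < L" for t using ab by auto
  have swap: "continuous_on (?U \<times> cbox a b) (\<lambda>(y, t). f t y * (\<phi> t - c))"
    if "continuous_on ({-L<..<L} \<times> {-M<..<M}) (\<lambda>(x, y). f x y)" for f :: "real \<Rightarrow> real \<Rightarrow> real"
  proof -
    have "continuous_on (?U \<times> cbox a b) (\<lambda>p. (\<lambda>(x, y). f x y) (snd p, fst p))"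
      by (rule continuous_on_compose2[OF that]) (use ab in \<open>auto intro!: continuous_intros\<close>)
    then show ?thesis
      by (auto simp: case_prod_beta intro!: continuous_intros continuous_on_compose2[OF even_sol_cont(1)[of UNIV]])
  qed
  have slice: "(\<lambda>t. f t y * (\<phi> t - c)) integrable_on cbox a b"
    if "continuous_on ({-L<..<L} \<times> {-M<..<M}) (\<lambda>(x, y). f x y)" "y \<in> ?U" for f :: "real \<Rightarrow> real \<Rightarrow> real" and y
  proof -
    have "continuous_on {a..b} (\<lambda>t. (\<lambda>(y, t). f t y * (\<phi> t - c)) (y, t))"
      by (rule continuous_on_compose2[OF swap[OF that(1)]]) (use that(2) in \<open>auto intro!: continuous_intros\<close>)
    then show ?thesis by (auto intro!: integrable_continuous_interval)
  qed
  have v_cont': "continuous_on ({-L<..<L} \<times> {-M<..<M}) (\<lambda>(x, y). v x y)"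
    by (rule continuous_on_subset[OF v_cont]) auto
  have "((\<lambda>y. integral (cbox a b) (\<lambda>t. v t y * (\<phi> t - c))) has_field_derivative
      integral (cbox a b) (\<lambda>t. vy t y * (\<phi> t - c))) (at y within ?U)"
  proof (rule leibniz_rule_field_derivative)
    show "((\<lambda>y. v t y * (\<phi> t - c)) has_field_derivative vy t y * (\<phi> t - c)) (at y within ?U)"
      if "y \<in> ?U" "t \<in> cbox a b" for y t
      by (rule has_field_derivative_at_within, rule DERIV_cmult_right, rule vy)
        (use that ab in auto)
  qed (use y slice[OF v_cont'] swap[OF vy_cont] in auto)
  then show "((\<lambda>y. integral {a..b} (\<lambda>t. v t y * (\<phi> t - c))) has_real_derivative
      integral {a..b} (\<lambda>t. vy t y * (\<phi> t - c))) (at y)" by (simp add: at)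
  have "((\<lambda>y. integral (cbox a b) (\<lambda>t. vy t y * (\<phi> t - c))) has_field_derivative
      integral (cbox a b) (\<lambda>t. vyy t y * (\<phi> t - c))) (at y within ?U)"
  proof (rule leibniz_rule_field_derivative)
    show "((\<lambda>y. vy t y * (\<phi> t - c)) has_field_derivative vyy t y * (\<phi> t - c)) (at y within ?U)"
      if "y \<in> ?U" "t \<in> cbox a b" for y t
      by (rule has_field_derivative_at_within, rule DERIV_cmult_right, rule vyy)
        (use that ab in auto)
  qed (use y slice[OF vy_cont] swap[OF vyy_cont] in auto)
  then show "((\<lambda>y. integral {a..b} (\<lambda>t. vy t y * (\<phi> t - c))) has_real_derivative
      integral {a..b} (\<lambda>t. vyy t y * (\<phi> t - c))) (at y)" by (simp add: at)
qed

text \<open>Uniform continuity on the closed rectangle and the zero boundary value. The bound is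
  uniform in \<open>y\<close>, as the boundary term left over by the integration by parts
  requires.\<close>

lemma v_small_near_left:
  assumes "0 < e"
  shows "\<exists>d>0. \<forall>x y. -L \<le> x \<longrightarrow> x \<le> L \<longrightarrow> x < -L + d \<longrightarrow> \<bar>y\<bar> \<le> M \<longrightarrow> \<bar>v x y\<bar> < e"
proof -
  have "uniformly_continuous_on ({-L..L} \<times> {-M..M}) (\<lambda>(x, y). v x y)"
    by (intro compact_uniformly_continuous v_cont compact_Times) auto
  then obtain d where d: "d > 0"
    "\<And>p q. p \<in> {-L..L} \<times> {-M..M} \<Longrightarrow> q \<in> {-L..L} \<times> {-M..M} \<Longrightarrow> dist q p < d \<Longrightarrow>
       dist ((\<lambda>(x, y). v x y) q) ((\<lambda>(x, y). v x y) p) < e"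
    using assms unfolding uniformly_continuous_on_def by metis
  have "\<bar>v x y\<bar> < e" if "-L \<le> x" "x \<le> L" "x < -L + d" "\<bar>y\<bar> \<le> M" for x y
  proof -
    have "dist (v x y) (v (-L) y) < e"
      using d(2)[of "(-L, y)" "(x, y)"] that L by (auto simp: dist_Pair_Pair dist_real_def abs_le_iff)
    moreover have "v (-L) y = 0" using zero[of "-L" y] that L by simp
    ultimately show ?thesis by (simp add: dist_real_def)
  qed
  then show ?thesis using d(1) by blast
qed

lemma truncated_integral_bound:
  assumes "-L \<le> a" "a \<le> b" "b \<le> L" "\<bar>y\<bar> \<le> M" "continuous_on {-L..L} k"
    and "\<And>t. t \<in> {-L..L} \<Longrightarrow> \<bar>k t\<bar> \<le> K" "\<And>t. t \<in> {-L..L} \<Longrightarrow> \<bar>v t y\<bar> \<le> B"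
  shows "\<bar>integral {a..b} (\<lambda>t. v t y * k t)\<bar> \<le> B * K * (b - a)"
proof -
  have "norm (integral {a..b} (\<lambda>t. v t y * k t)) \<le> (B * K) * (b - a)"
  proof (rule integral_bound[OF assms(2)])
    show "continuous_on {a..b} (\<lambda>t. v t y * k t)"
      by (intro continuous_intros continuous_on_subset[OF cont_slice_x[OF assms(4)]]
          continuous_on_subset[OF assms(5)]) (use assms in auto)
    show "norm (v t y * k t) \<le> B * K" if "t \<in> {a..b}" for t
      unfolding real_norm_def abs_mult
      using assms(1,3) that order_trans[OF abs_ge_zero assms(7)[of t]]
      by (intro mult_mono assms(6,7)) auto
  qed
  then show ?thesis by simp
qed

text \<open>The integral is truncated to \<open>[a n, x]\<close> with \<open>a n\<close> tending to
  \<open>-L\<close>. The second derivatives of the truncations converge uniformly near the given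
  point, and \<open>second_derivative_limit\<close> hands them on to \<open>P x\<close>.\<close>

lemma P_has_derivative_y:
  assumes x: "\<bar>x\<bar> < L" and y: "\<bar>y\<bar> < M"
  shows "(P x has_real_derivative deriv (P x) y) (at y)"
    and "(deriv (P x) has_real_derivative
      v x y * \<phi>' x - vx x y * \<phi> x + (y\<^sup>2 / 4 + even_level L - \<Lambda>) * P x y) (at y)"
proof -
  \<comment> \<open>Two nested neighbourhoods of \<open>y\<close>, obtained by halving the distances
    to \<open>-M\<close> and \<open>M\<close>: \<open>second_derivative_limit\<close> wants
    \<open>h\<close> continuous on an interval larger than \<open>[p, q]\<close>.\<close>
  define p q where "p = (y - M) / 2" and "q = (y + M) / 2"
  define p' q' where "p' = (p - M) / 2" and "q' = (q + M) / 2"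
  have pq: "-M < p'" "p' < p" "p < y" "y < q" "q < q'" "q' < M"
    using y by (auto simp: p_def q_def p'_def q'_def abs_less_iff field_simps)
  define a where "a n = -L + (x + L) / real (n + 2)" for n :: nat
  have a: "-L < a n" "a n \<le> x" for n
  proof -
    have "0 < (x + L) / real (n + 2)" using x by (auto simp: abs_less_iff)
    moreover have "(x + L) / real (n + 2) \<le> (x + L) / 1"
      using x by (intro divide_left_mono) auto
    ultimately show "-L < a n" "a n \<le> x" by (auto simp: a_def)
  qed
  have a_lim: "a \<longlonglongrightarrow> -L"
  proof -
    have "(\<lambda>n. -L + (x + L) / real (n + 2)) \<longlonglongrightarrow> -L + 0"
      by (intro tendsto_intros lim_const_over_n[THEN LIMSEQ_ignore_initial_segment])
    then show ?thesis by (simp add: a_def[abs_def])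
  qed
  \<comment> \<open>This constant cancels the boundary term with \<open>vx (a n) y\<close> in
    \<open>integral_yy_by_parts\<close>, and it tends to \<open>\<phi> (-L) = 0\<close>.\<close>
  define c where "c n = \<phi> (a n)" for n
  have c_lim: "c \<longlonglongrightarrow> 0"
  proof -
    have "isCont \<phi> (-L)" using even_sol_DERIV(1) by (rule DERIV_isCont)
    then have "(\<lambda>n. \<phi> (a n)) \<longlonglongrightarrow> \<phi> (-L)" using a_lim by (rule isCont_tendsto_compose)
    then show ?thesis using L by (simp add: c_def[abs_def])
  qed
  obtain B where B: "B > 0" "\<And>x y. \<bar>x\<bar> \<le> L \<Longrightarrow> \<bar>y\<bar> \<le> M \<Longrightarrow> \<bar>v x y\<bar> \<le> B" 
    using v_bounded by blast
  have bdd: "\<exists>K>0. \<forall>t\<in>{r..s}. \<bar>k t\<bar> \<le> K" if "continuous_on {r..s} k" for k :: "real \<Rightarrow> real" and r s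
    using compact_imp_bounded[OF compact_continuous_image[OF that compact_Icc]]
    unfolding bounded_pos by auto
  obtain K0 where K0: "K0 > 0" "\<And>t. t \<in> {-L..L} \<Longrightarrow> \<bar>\<phi> t\<bar> \<le> K0"
    using bdd[OF even_sol_cont(1)] by blast
  obtain K1 where K1: "K1 > 0" "\<And>t. t \<in> {-L..L} \<Longrightarrow> \<bar>\<phi>' t\<bar> \<le> K1"
    using bdd[OF even_sol_cont(2)] by blast
  have vx_slice: "continuous_on {p'..q'} (\<lambda>y. vx x y)"
  proof -
    have "continuous_on {p'..q'} (\<lambda>y. (\<lambda>(x, y). vx x y) (x, y))"
      by (rule continuous_on_compose2[OF vx_cont]) (use x pq in \<open>auto intro!: continuous_intros\<close>)
    then show ?thesis by simp
  qed
  have v_slice: "continuous_on {p'..q'} (\<lambda>y. v x y)"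
    by (rule continuous_on_subset[OF cont_slice_y]) (use x pq in auto)
  have P_slice: "continuous_on {p'..q'} (\<lambda>y. P x y)"
  proof -
    have "continuous_on {p'..q'} (\<lambda>y. (\<lambda>(x, y). P x y) (x, y))"
      by (rule continuous_on_compose2[OF P_cont]) (use x pq in \<open>auto intro!: continuous_intros\<close>)
    then show ?thesis by simp
  qed
  obtain Bx where Bx: "Bx > 0" "\<And>y. y \<in> {p'..q'} \<Longrightarrow> \<bar>vx x y\<bar> \<le> Bx"
    using bdd[OF vx_slice] by blast
  define k where "k y = y\<^sup>2 / 4 + even_level L - \<Lambda>" for y
  have kc: "continuous_on {-M..M} k"
    unfolding k_def by (intro continuous_intros) auto
  obtain K2 where K2: "K2 > 0" "\<And>y. y \<in> {-M..M} \<Longrightarrow> \<bar>k y\<bar> \<le> K2"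
    using bdd[OF kc] by blast
  define K3 where "K3 = L\<^sup>2 / 4 + M\<^sup>2 / 4 + \<bar>\<Lambda>\<bar>"
  have K3: "\<bar>(t\<^sup>2 + y\<^sup>2) / 4 - \<Lambda>\<bar> \<le> K3" if "\<bar>t\<bar> \<le> L" "\<bar>y\<bar> \<le> M" for t y
  proof -
    have "t\<^sup>2 \<le> L\<^sup>2" "y\<^sup>2 \<le> M\<^sup>2" using that by (auto simp: abs_le_square_iff[symmetric])
    then have "\<bar>(t\<^sup>2 + y\<^sup>2) / 4\<bar> \<le> L\<^sup>2 / 4 + M\<^sup>2 / 4" by simp
    then show ?thesis unfolding K3_def by linarith
  qed
  define f f1 f2 where "f n y = integral {a n..x} (\<lambda>t. v t y * (\<phi> t - c n))"
    and "f1 n y = integral {a n..x} (\<lambda>t. vy t y * (\<phi> t - c n))"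
    and "f2 n y = integral {a n..x} (\<lambda>t. vyy t y * (\<phi> t - c n))" for n y
  define h where "h y = v x y * \<phi>' x - vx x y * \<phi> x + k y * P x y" for y
  have yM: "\<bar>y\<bar> < M" if "y \<in> {p'..q'}" for y using that pq by (auto simp: abs_less_iff)
  have Pa: "integral {a n..x} (\<lambda>t. v t y * \<phi> t) = P x y - P (a n) y" if "\<bar>y\<bar> \<le> M" for n y
  proof -
    have "continuous_on {-L..x} (\<lambda>t. v t y * \<phi> t)"
      by (intro continuous_intros even_sol_cont continuous_on_subset[OF cont_slice_x[OF that]]) (use x in auto)
    then have "P (a n) y + integral {a n..x} (\<lambda>t. v t y * \<phi> t) = P x y"
      unfolding P_def using a[of n] by (intro Henstock_Kurzweil_Integration.integral_combine integrable_continuous_interval) auto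
    then show ?thesis by simp
  qed
  have Bv: "\<bar>v t y\<bar> \<le> B" if "t \<in> {-L..L}" "\<bar>y\<bar> \<le> M" for t y
    using that by (intro B(2)) auto
  have Pa_le: "\<bar>P (a n) y\<bar> \<le> B * K0 * (a n + L)" if "\<bar>y\<bar> \<le> M" for n y
  proof -
    have "\<bar>integral {-L..a n} (\<lambda>t. v t y * \<phi> t)\<bar> \<le> B * K0 * (a n - (-L))"
      by (rule truncated_integral_bound[OF _ _ _ that even_sol_cont(1) K0(2) Bv]) (use a[of n] x that in auto)
    then show ?thesis by (simp add: P_def)
  qed
  have J0: "\<bar>integral {a n..x} (\<lambda>t. v t y * 1)\<bar> \<le> B * 1 * (x - a n)" if "\<bar>y\<bar> \<le> M" for n y
    by (rule truncated_integral_bound) (use a[of n] x that Bv in auto)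
  have J1: "\<bar>integral {a n..x} (\<lambda>t. v t y * ((t\<^sup>2 + y\<^sup>2) / 4 - \<Lambda>))\<bar> \<le> B * K3 * (x - a n)" if "\<bar>y\<bar> \<le> M" for n y
    by (rule truncated_integral_bound) (use a[of n] x that Bv K3 in \<open>auto intro!: continuous_intros\<close>)
  have f_eq: "f n y = P x y - P (a n) y - c n * integral {a n..x} (\<lambda>t. v t y * 1)" if "\<bar>y\<bar> \<le> M" for n y
  proof -
    have cs: "continuous_on {a n..x} (\<lambda>t. v t y)"
      by (rule continuous_on_subset[OF cont_slice_x[OF that]]) (use x a[of n] in auto)
    have "f n y = integral {a n..x} (\<lambda>t. v t y * \<phi> t - c n * (v t y * 1))"
      unfolding f_def by (intro integral_cong) (simp add: algebra_simps)
    also have "\<dots> = integral {a n..x} (\<lambda>t. v t y * \<phi> t) - integral {a n..x} (\<lambda>t. c n * (v t y * 1))"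
      by (intro integral_diff integrable_continuous_interval continuous_intros cs even_sol_cont)
    finally show ?thesis by (simp add: Pa[OF that])
  qed
  \<comment> \<open>All terms of the error are small: \<open>P (a n) y\<close> and
    \<open>c n\<close> tend to \<open>0\<close>, and \<open>v (a n) y\<close> is close to its
    boundary value \<open>0\<close>.\<close>
  have f2_eq: "f2 n y - h y = - k y * P (a n) y - c n * integral {a n..x} (\<lambda>t. v t y * ((t\<^sup>2 + y\<^sup>2) / 4 - \<Lambda>))
      + c n * vx x y - v (a n) y * \<phi>' (a n)" if "\<bar>y\<bar> < M" for n y
    using integral_yy_by_parts[of "a n" x y "c n"] a[of n] x that Pa[of y n]
    unfolding f2_def h_def k_def[symmetric] by (simp add: c_def algebra_simps)
  have lim: "(\<lambda>n. f n y) \<longlonglongrightarrow> P x y" if "\<bar>y\<bar> \<le> M" for y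
  proof -
    have "(\<lambda>n. B * K0 * (a n + L) + \<bar>c n\<bar> * (B * 1 * (x - a n))) \<longlonglongrightarrow> B * K0 * (-L + L) + \<bar>0\<bar> * (B * 1 * (x - (-L)))"
      by (intro tendsto_intros a_lim c_lim)
    then have "(\<lambda>n. B * K0 * (a n + L) + \<bar>c n\<bar> * (B * 1 * (x - a n))) \<longlonglongrightarrow> 0" by simp
    then have "(\<lambda>n. f n y - P x y) \<longlonglongrightarrow> 0"
    proof (rule Lim_null_comparison[rotated])
      show "\<forall>\<^sub>F n in sequentially. norm (f n y - P x y) \<le> B * K0 * (a n + L) + \<bar>c n\<bar> * (B * 1 * (x - a n))"
      proof (rule always_eventually, rule allI)
        fix n
        have "\<bar>f n y - P x y\<bar> \<le> \<bar>P (a n) y\<bar> + \<bar>c n\<bar> * \<bar>integral {a n..x} (\<lambda>t. v t y * 1)\<bar>"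
          unfolding f_eq[OF that] abs_mult[symmetric] by linarith
        also have "\<dots> \<le> B * K0 * (a n + L) + \<bar>c n\<bar> * (B * 1 * (x - a n))"
          by (intro add_mono Pa_le mult_left_mono J0 that) auto
        finally show "norm (f n y - P x y) \<le> B * K0 * (a n + L) + \<bar>c n\<bar> * (B * 1 * (x - a n))" by simp
      qed
    qed
    then show ?thesis by (simp add: LIM_zero_iff)
  qed
  have unif: "uniform_limit {p..q} f2 h sequentially"
  proof (rule uniform_limitI)
    fix e :: real assume "0 < e"
    define s where "s n = K2 * (B * K0 * (a n + L)) + \<bar>c n\<bar> * (B * K3 * (x - a n)) + \<bar>c n\<bar> * Bx" for n
    have "s \<longlonglongrightarrow> K2 * (B * K0 * (-L + L)) + \<bar>0\<bar> * (B * K3 * (x - (-L))) + \<bar>0\<bar> * Bx"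
      unfolding s_def by (intro tendsto_intros a_lim c_lim)
    then have "s \<longlonglongrightarrow> 0" by simp
    then have s: "\<forall>\<^sub>F n in sequentially. s n < e / 2"
      using \<open>0 < e\<close> by (intro order_tendstoD) auto
    obtain d where d: "d > 0" "\<And>x y. -L \<le> x \<Longrightarrow> x \<le> L \<Longrightarrow> x < -L + d \<Longrightarrow> \<bar>y\<bar> \<le> M \<Longrightarrow> \<bar>v x y\<bar> < e / (2 * K1)"
      using v_small_near_left[of "e / (2 * K1)"] \<open>0 < e\<close> K1(1) by auto
    have "\<forall>\<^sub>F n in sequentially. a n < -L + d"
      using a_lim d(1) by (intro order_tendstoD) auto
    with s show "\<forall>\<^sub>F n in sequentially. \<forall>y\<in>{p..q}. dist (f2 n y) (h y) < e"
    proof eventually_elim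
      case (elim n)
      show ?case
      proof
        fix y assume "y \<in> {p..q}"
        then have y: "y \<in> {p'..q'}" using pq by auto
        note yl = yM[OF y]
        have 1: "\<bar>k y * P (a n) y\<bar> \<le> K2 * (B * K0 * (a n + L))"
          unfolding abs_mult using yl K2(1) by (intro mult_mono K2 Pa_le) auto
        have 2: "\<bar>c n * integral {a n..x} (\<lambda>t. v t y * ((t\<^sup>2 + y\<^sup>2) / 4 - \<Lambda>))\<bar> \<le> \<bar>c n\<bar> * (B * K3 * (x - a n))"
          unfolding abs_mult using yl by (intro mult_left_mono J1) auto
        have 3: "\<bar>c n * vx x y\<bar> \<le> \<bar>c n\<bar> * Bx"
          unfolding abs_mult by (intro mult_left_mono Bx y) auto
        have "\<bar>v (a n) y * \<phi>' (a n)\<bar> \<le> e / (2 * K1) * K1"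
          unfolding abs_mult
        proof (intro mult_mono K1)
          show "\<bar>v (a n) y\<bar> \<le> e / (2 * K1)"
            using a[of n] x yl elim(2) by (intro less_imp_le d(2)) (auto simp: abs_less_iff)
        qed (use a[of n] x \<open>0 < e\<close> K1(1) in auto)
        then have 4: "\<bar>v (a n) y * \<phi>' (a n)\<bar> \<le> e / 2" using K1(1) by simp
        have "\<bar>f2 n y - h y\<bar> \<le> \<bar>k y * P (a n) y\<bar> + \<bar>c n * integral {a n..x} (\<lambda>t. v t y * ((t\<^sup>2 + y\<^sup>2) / 4 - \<Lambda>))\<bar>
            + \<bar>c n * vx x y\<bar> + \<bar>v (a n) y * \<phi>' (a n)\<bar>"
          unfolding f2_eq[OF yl] by linarith
        also have "\<dots> \<le> s n + e / 2" unfolding s_def using 1 2 3 4 by linarith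
        also have "\<dots> < e" using elim(1) by simp
        finally show "dist (f2 n y) (h y) < e" by (simp add: dist_real_def)
      qed
    qed
  qed
  have hc: "continuous_on {p'..q'} h"
    unfolding h_def k_def by (intro continuous_intros v_slice vx_slice P_slice) auto
  have xa: "\<bar>y\<bar> < M" if "y \<in> {p..q}" for y using yM[of y] that pq by auto
  have fd: "(f n has_real_derivative f1 n y) (at y)" "(f1 n has_real_derivative f2 n y) (at y)"
    if "y \<in> {p..q}" for n y
    using truncated_has_derivative_y[OF a(1)[of n] a(2)[of n], of y "c n"] x xa[OF that] by (simp_all add: f_def[abs_def] f1_def[abs_def] f2_def)
  have y': "y \<in> {p<..<q}" using pq by simp
  have pq': "p < q" using pq by simp
  have limpq: "(\<lambda>n. f n y) \<longlonglongrightarrow> P x y" if "y \<in> {p..q}" for y using lim[of y] xa[OF that] by simp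
  note * = second_derivative_limit[OF pq' fd limpq unif hc pq(2) pq(5) y']
  show "(P x has_real_derivative deriv (P x) y) (at y)" by (rule *)
  show "(deriv (P x) has_real_derivative
      v x y * \<phi>' x - vx x y * \<phi> x + (y\<^sup>2 / 4 + even_level L - \<Lambda>) * P x y) (at y)"
    using *(2) by (simp add: h_def k_def)
qed

end

text \<open>Serves both to pass from \<open>v\<close> to \<open>-v\<close> and to combine two
  eigenfunctions so that their moments cancel.\<close>

lemma rect_sol_linear:
  assumes "rect_sol L M \<Lambda> v vx vxx vy vyy" "rect_sol L M \<Lambda> w wx wxx wy wyy"
  shows "rect_sol L M \<Lambda> (\<lambda>x y. a * v x y + b * w x y) (\<lambda>x y. a * vx x y + b * wx x y)
    (\<lambda>x y. a * vxx x y + b * wxx x y) (\<lambda>x y. a * vy x y + b * wy x y) (\<lambda>x y. a * vyy x y + b * wyy x y)"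
proof -
  interpret v: rect_sol L M \<Lambda> v vx vxx vy vyy by fact
  interpret w: rect_sol L M \<Lambda> w wx wxx wy wyy by fact
  have cont: "continuous_on A (\<lambda>(x, y). a * f x y + b * g x y)"
    if "continuous_on A (\<lambda>(x, y). f x y)" "continuous_on A (\<lambda>(x, y). g x y)" for A f g
    using that unfolding case_prod_beta by (intro continuous_intros)
  show ?thesis
  proof
    show "a * vxx x y + b * wxx x y + (a * vyy x y + b * wyy x y)
      = ((x\<^sup>2 + y\<^sup>2) / 4 - \<Lambda>) * (a * v x y + b * w x y)" if "\<bar>x\<bar> < L" "\<bar>y\<bar> < M" for x y
    proof -
      have "a * vxx x y + b * wxx x y + (a * vyy x y + b * wyy x y)
        = a * (vxx x y + vyy x y) + b * (wxx x y + wyy x y)" by (simp add: algebra_simps)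
      also have "\<dots> = ((x\<^sup>2 + y\<^sup>2) / 4 - \<Lambda>) * (a * v x y + b * w x y)"
        unfolding v.eq[OF that] w.eq[OF that] by (simp add: field_simps)
      finally show ?thesis .
    qed
  qed (intro v.L v.M cont v.v_cont v.vx_cont v.vxx_cont v.vy_cont v.vyy_cont
      w.v_cont w.vx_cont w.vxx_cont w.vy_cont w.vyy_cont DERIV_add DERIV_cmult
      v.vx v.vxx v.vy v.vyy w.vx w.vxx w.vy w.vyy; assumption | simp add: v.zero w.zero)+
qed

section \<open>Maximum principle for \<open>P\<close> and the equation of the full moment\<close>

context rect_sol
begin

text \<open>Reflection moves the right half of the full moment to the left half, where it is a value
  of \<open>P\<close> at an interior point.\<close>

lemma rect_sol_reflect:
  "rect_sol L M \<Lambda> (\<lambda>x y. v (-x) y) (\<lambda>x y. - vx (-x) y) (\<lambda>x y. vxx (-x) y)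
     (\<lambda>x y. vy (-x) y) (\<lambda>x y. vyy (-x) y)"
proof -
  have cont: "continuous_on ({-L..L} \<times> {-M..M}) (\<lambda>(x, y). f (-x) y)"
    if "continuous_on ({-L..L} \<times> {-M..M}) (\<lambda>(x, y). f x y)" for f :: "real \<Rightarrow> real \<Rightarrow> real"
  proof -
    have "continuous_on ({-L..L} \<times> {-M..M}) (\<lambda>p. (\<lambda>(x, y). f x y) (- fst p, snd p))"
      by (rule continuous_on_compose2[OF that], intro continuous_intros) auto
    then show ?thesis by (simp add: case_prod_beta)
  qed
  have cont': "continuous_on ({-L<..<L} \<times> {-M<..<M}) (\<lambda>(x, y). f (-x) y)"
    if "continuous_on ({-L<..<L} \<times> {-M<..<M}) (\<lambda>(x, y). f x y)" for f :: "real \<Rightarrow> real \<Rightarrow> real"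
  proof -
    have "continuous_on ({-L<..<L} \<times> {-M<..<M}) (\<lambda>p. (\<lambda>(x, y). f x y) (- fst p, snd p))"
      by (rule continuous_on_compose2[OF that], intro continuous_intros) auto
    then show ?thesis by (simp add: case_prod_beta)
  qed
  show ?thesis
  proof
    show "continuous_on ({-L<..<L} \<times> {-M<..<M}) (\<lambda>(x, y). - vx (-x) y)"
      using continuous_on_minus[OF cont'[OF vx_cont]] by (simp add: case_prod_beta)
    show "((\<lambda>x. v (-x) y) has_real_derivative - vx (-x) y) (at x)" if "\<bar>x\<bar> < L" "\<bar>y\<bar> < M" for x y
      using vx[of "-x" y] that by (subst DERIV_mirror[symmetric]) simp
    show "((\<lambda>x. - vx (-x) y) has_real_derivative vxx (-x) y) (at x)" if "\<bar>x\<bar> < L" "\<bar>y\<bar> < M" for x y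
      using DERIV_minus[OF DERIV_mirror[THEN iffD1, OF vxx[of "-x" y]]] that by simp
    show "vxx (-x) y + vyy (-x) y = ((x\<^sup>2 + y\<^sup>2) / 4 - \<Lambda>) * v (-x) y" if "\<bar>x\<bar> < L" "\<bar>y\<bar> < M" for x y
      using eq[of "-x" y] that by simp
  qed (use L M zero in \<open>auto intro!: cont cont' v_cont vxx_cont vy_cont vyy_cont vy vyy\<close>)
qed

text \<open>
  The transform \<open>P\<close> is the supersymmetric partner of \<open>v\<close> up to the factor \<open>\<phi>\<close>: it trades the
  first Dirichlet level in \<open>x\<close> for the second one. If \<open>P\<close> vanishes on the boundary, the maximum principle
  applies to its quotient by a positive solution of the same equation.
\<close>

lemma P_nonpos:
  assumes \<Lambda>: "\<Lambda> < odd_level L + even_level M"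
    and P0: "\<And>y. \<bar>y\<bar> \<le> M \<Longrightarrow> P L y = 0"
    and xy: "\<bar>x\<bar> \<le> L" "\<bar>y\<bar> \<le> M"
  shows "P x y \<le> 0"
proof (rule ccontr)
  assume "\<not> P x y \<le> 0"
  \<comment> \<open>The room below \<open>odd_level L + even_level M\<close> is shared out:
    \<open>F1\<close> and \<open>F2\<close> stay below the two levels but still add up to more than
    \<open>\<Lambda>\<close>.\<close>
  obtain F2 where F2: "\<Lambda> - odd_level L < F2" "F2 < even_level M"
    using dense[of "\<Lambda> - odd_level L" "even_level M"] \<Lambda> by auto
  obtain F1 where "max (\<Lambda> - F2) (even_level L) < F1" and F1: "F1 < odd_level L"
    using dense[of "max (\<Lambda> - F2) (even_level L)" "odd_level L"] F2 even_level_less_odd_level[OF L] by auto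
  then have F1': "\<Lambda> < F1 + F2" "even_level L < F1" by auto
  let ?S = "odd_sol F1" and ?S' = "odd_sol' F1" and ?\<chi> = "even_sol F2" and ?\<chi>' = "even_sol' F2"
  \<comment> \<open>The Darboux partner of \<open>?S\<close>: the derivative of \<open>W\<close> is
    a multiple of \<open>\<phi> * ?S\<close>, as that of \<open>P\<close> is
    \<open>v * \<phi>\<close>. The product \<open>W x * ?\<chi> y\<close> is the positive function
    by which \<open>P\<close> gets divided.\<close>
  define W where "W x = \<phi> x * ?S' x - \<phi>' x * ?S x" for x
  have W: "(W has_real_derivative (even_level L - F1) * \<phi> x * ?S x) (at x)" for x
    unfolding W_def[abs_def]
    by (rule DERIV_cong[OF wronskian_has_derivative[OF even_sol_DERIV odd_sol_DERIV]]) simp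
  have W2: "((\<lambda>x. (even_level L - F1) * \<phi> x * ?S x) has_real_derivative
      (even_level L - F1) * (\<phi>' x * ?S x + \<phi> x * ?S' x)) (at x)" for x
    unfolding mult.assoc
    by (rule DERIV_cong[OF DERIV_cmult[OF DERIV_mult[OF even_sol_DERIV(1) odd_sol_DERIV(1)]]]) simp
  \<comment> \<open>At \<open>L\<close> only \<open>- \<phi>' L * ?S L\<close> is left, and the
    Wronskian identity at energy \<open>even_level L\<close> gives
    \<open>\<phi>' L < 0\<close>.\<close>
  have W_L: "0 < W L"
  proof -
    have "- \<phi>' L * odd_sol (even_level L) L = 1"
      using wronskian_even_odd[of "even_level L" L] L by simp
    moreover have "0 < odd_sol (even_level L) L"
      using odd_sol_pos[OF L even_level_less_odd_level[OF L]] L by simp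
    ultimately have "0 < - \<phi>' L" by (metis zero_less_mult_pos2 zero_less_one)
    then show ?thesis using odd_sol_pos[OF L F1, of L] L by (simp add: W_def mult_less_0_iff)
  qed
  \<comment> \<open>\<open>W\<close> is even and decreasing on \<open>[0, L]\<close>, so
    \<open>W L\<close> is its least value.\<close>
  have W_pos: "0 < W x" if "\<bar>x\<bar> \<le> L" for x
  proof -
    have "W L \<le> W \<bar>x\<bar>"
    proof (rule DERIV_nonpos_imp_decreasing_open[OF that])
      fix t assume t: "\<bar>x\<bar> < t" "t < L"
      then have "0 < \<phi> t" "0 < ?S t"
        using even_level_sol_pos[OF L, of t] odd_sol_pos[OF L F1, of t] by auto
      then have "(even_level L - F1) * \<phi> t * ?S t \<le> 0"
        using F1'(2) by (simp add: mult_le_0_iff)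
      then show "\<exists>d. DERIV W t :> d \<and> d \<le> 0" using W by blast
    qed (rule DERIV_continuous_on[OF DERIV_subset[OF W]], simp)
    moreover have "W \<bar>x\<bar> = W x" by (simp add: W_def abs_if)
    ultimately show ?thesis using W_L by simp
  qed
  have \<chi>_pos: "0 < ?\<chi> y" if "\<bar>y\<bar> \<le> M" for y by (rule even_sol_pos[OF M F2(2) that])
  define R where "R p = P (fst p) (snd p) / (W (fst p) * ?\<chi> (snd p))" for p
  have Wc: "continuous_on A W" for A by (rule DERIV_continuous_on[OF DERIV_subset[OF W]]) simp
  have "continuous_on ({-L..L} \<times> {-M..M}) R"
    unfolding R_def
  proof (intro continuous_on_divide continuous_on_mult)
    show "continuous_on ({-L..L} \<times> {-M..M}) (\<lambda>p. P (fst p) (snd p))"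
      using P_cont by (simp add: case_prod_beta)
    show "continuous_on ({-L..L} \<times> {-M..M}) (\<lambda>p. W (fst p))"
      by (rule continuous_on_compose2[OF Wc[of UNIV]]) (auto intro!: continuous_intros)
    show "continuous_on ({-L..L} \<times> {-M..M}) (\<lambda>p. ?\<chi> (snd p))"
      by (rule continuous_on_compose2[OF even_sol_cont(1)[of UNIV]]) (auto intro!: continuous_intros)
    show "\<forall>p\<in>{-L..L} \<times> {-M..M}. W (fst p) * ?\<chi> (snd p) \<noteq> 0"
      using W_pos \<chi>_pos by (force simp: abs_le_iff)
  qed
  moreover have "compact ({-L..L} \<times> {-M..M})" by (intro compact_Times) auto
  ultimately obtain p where p: "p \<in> {-L..L} \<times> {-M..M}" "\<And>q. q \<in> {-L..L} \<times> {-M..M} \<Longrightarrow> R q \<le> R p"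
    using continuous_attains_sup[of "{-L..L} \<times> {-M..M}" R] L M by fastforce
  obtain x0 y0 where p_eq: "p = (x0, y0)" by fastforce
  have x0y0: "\<bar>x0\<bar> \<le> L" "\<bar>y0\<bar> \<le> M" using p(1) by (auto simp: p_eq)
  define r where "r = R p"
  have "0 < R (x, y)" using \<open>\<not> P x y \<le> 0\<close> W_pos[OF xy(1)] \<chi>_pos[OF xy(2)] by (simp add: R_def)
  also have "R (x, y) \<le> r" unfolding r_def using xy by (intro p(2)) auto
  finally have r: "0 < r" .
  have le: "P s t \<le> r * W s * ?\<chi> t" if "\<bar>s\<bar> \<le> L" "\<bar>t\<bar> \<le> M" for s t
  proof -
    have "R (s, t) \<le> r" unfolding r_def using that by (intro p(2)) auto
    then show ?thesis using W_pos[OF that(1)] \<chi>_pos[OF that(2)] by (simp add: R_def field_simps)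
  qed
  have P_eq: "P x0 y0 = r * W x0 * ?\<chi> y0"
    using W_pos[OF x0y0(1)] \<chi>_pos[OF x0y0(2)] by (simp add: r_def R_def p_eq)
  then have P_pos: "0 < P x0 y0" using r W_pos[OF x0y0(1)] \<chi>_pos[OF x0y0(2)] by simp
  \<comment> \<open>The maximum is not on the boundary: on the right by \<open>P0\<close>, on the
    left because the integral runs over a single point, at top and bottom because \<open>v\<close>
    is zero there.\<close>
  have "x0 \<noteq> L" using P0[of y0] x0y0 P_pos by auto
  moreover have "x0 \<noteq> -L" using P_pos by (auto simp: P_def)
  ultimately have x0: "\<bar>x0\<bar> < L" using x0y0(1) by (auto simp: abs_less_iff abs_le_iff)
  have y0: "\<bar>y0\<bar> < M"
  proof (rule ccontr)
    assume "\<not> \<bar>y0\<bar> < M"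
    then have "\<bar>y0\<bar> = M" using x0y0(2) by simp
    then have "P x0 y0 = integral {-L..x0} (\<lambda>t. 0)"
      unfolding P_def using x0y0 zero by (intro integral_cong) auto
    then show False using P_pos by simp
  qed
  define dx where "dx = L - \<bar>x0\<bar>"
  define dy where "dy = M - \<bar>y0\<bar>"
  have dx: "0 < dx" "\<bar>t\<bar> < L" if "\<bar>t - x0\<bar> < dx" for t using that x0 by (auto simp: dx_def)
  have dx0: "0 < dx" and dy0: "0 < dy" using x0 y0 by (auto simp: dx_def dy_def)
  have dy: "\<bar>t\<bar> < M" if "\<bar>t - y0\<bar> < dy" for t using that by (auto simp: dy_def)
  \<comment> \<open>First- and second-order conditions for the \<open>x\<close>-slice of
    \<open>P - r * W * ?\<chi>\<close>, whose maximum \<open>0\<close> is attained at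
    \<open>(x0, y0)\<close>; \<open>Y\<close> below is the second-order condition for the
    \<open>y\<close>-slice.\<close>
  have X: "v x0 y0 * \<phi> x0 - r * ?\<chi> y0 * ((even_level L - F1) * \<phi> x0 * ?S x0) = 0"
     "vx x0 y0 * \<phi> x0 + \<phi>' x0 * v x0 y0
       - r * ?\<chi> y0 * ((even_level L - F1) * (\<phi>' x0 * ?S x0 + \<phi> x0 * ?S' x0)) \<le> 0"
  proof -
    note max = second_derivative_at_max[OF dx0, of x0 "\<lambda>t. P t y0 - r * ?\<chi> y0 * W t"
        "\<lambda>t. v t y0 * \<phi> t - r * ?\<chi> y0 * ((even_level L - F1) * \<phi> t * ?S t)"]
    have 1: "((\<lambda>t. P t y0 - r * ?\<chi> y0 * W t) has_real_derivative
        v t y0 * \<phi> t - r * ?\<chi> y0 * ((even_level L - F1) * \<phi> t * ?S t)) (at t)" if "\<bar>t - x0\<bar> < dx" for t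
      by (intro DERIV_diff DERIV_cmult W P_has_derivative_x dx(2) that x0y0)
    have 2: "((\<lambda>t. v t y0 * \<phi> t - r * ?\<chi> y0 * ((even_level L - F1) * \<phi> t * ?S t)) has_real_derivative
        (vx x0 y0 * \<phi> x0 + \<phi>' x0 * v x0 y0)
       - r * ?\<chi> y0 * ((even_level L - F1) * (\<phi>' x0 * ?S x0 + \<phi> x0 * ?S' x0))) (at x0)"
      by (intro DERIV_diff DERIV_cmult W2 DERIV_mult vx x0 y0 even_sol_DERIV)
    have 3: "P t y0 - r * ?\<chi> y0 * W t \<le> P x0 y0 - r * ?\<chi> y0 * W x0" if "\<bar>t - x0\<bar> < dx" for t
      using le[of t y0] dx(2)[OF that] x0y0(2) P_eq by (simp add: mult_ac)
    show "v x0 y0 * \<phi> x0 - r * ?\<chi> y0 * ((even_level L - F1) * \<phi> x0 * ?S x0) = 0"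
      by (rule max(1)[OF 1 2 3])
    show "vx x0 y0 * \<phi> x0 + \<phi>' x0 * v x0 y0
       - r * ?\<chi> y0 * ((even_level L - F1) * (\<phi>' x0 * ?S x0 + \<phi> x0 * ?S' x0)) \<le> 0"
      by (rule max(2)[OF 1 2 3])
  qed
  have Y: "v x0 y0 * \<phi>' x0 - vx x0 y0 * \<phi> x0 + (y0\<^sup>2 / 4 + even_level L - \<Lambda>) * P x0 y0
      - r * W x0 * ((y0\<^sup>2 / 4 - F2) * ?\<chi> y0) \<le> 0"
  proof (rule second_derivative_at_max(2)[OF dy0, of y0 "\<lambda>t. P x0 t - r * W x0 * ?\<chi> t"
        "\<lambda>t. deriv (P x0) t - r * W x0 * ?\<chi>' t"])
    show "((\<lambda>t. P x0 t - r * W x0 * ?\<chi> t) has_real_derivative deriv (P x0) t - r * W x0 * ?\<chi>' t) (at t)"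
      if "\<bar>t - y0\<bar> < dy" for t
      by (intro DERIV_diff DERIV_cmult even_sol_DERIV P_has_derivative_y x0 dy that)
    show "((\<lambda>t. deriv (P x0) t - r * W x0 * ?\<chi>' t) has_real_derivative
      v x0 y0 * \<phi>' x0 - vx x0 y0 * \<phi> x0 + (y0\<^sup>2 / 4 + even_level L - \<Lambda>) * P x0 y0
      - r * W x0 * ((y0\<^sup>2 / 4 - F2) * ?\<chi> y0)) (at y0)"
      by (intro DERIV_diff DERIV_cmult even_sol_DERIV P_has_derivative_y x0 y0)
    show "P x0 t - r * W x0 * ?\<chi> t \<le> P x0 y0 - r * W x0 * ?\<chi> y0" if "\<bar>t - y0\<bar> < dy" for t
      using le[of x0 t] dy[OF that] x0y0(1) P_eq by simp
  qed
  have "0 < \<phi> x0" by (rule even_level_sol_pos[OF L x0])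
  moreover have "(v x0 y0 - r * ?\<chi> y0 * (even_level L - F1) * ?S x0) * \<phi> x0 = 0"
    using X(1) by (simp add: algebra_simps)
  ultimately have v_eq: "v x0 y0 = r * ?\<chi> y0 * (even_level L - F1) * ?S x0" by simp
  \<comment> \<open>Adding the two second-order conditions cancels \<open>vx\<close>. With the value
    of \<open>v\<close> from the first-order condition, the rest collapses to
    \<open>F1 + F2 - \<Lambda>\<close> times the value of \<open>P\<close>.\<close>
  have "(F1 + F2 - \<Lambda>) * (r * W x0 * ?\<chi> y0) \<le> 0"
    using add_mono[OF X(2) Y] unfolding v_eq P_eq by (simp add: W_def field_simps)
  moreover have "0 < (F1 + F2 - \<Lambda>) * (r * W x0 * ?\<chi> y0)"
    using F1'(1) r W_pos[OF x0y0(1)] \<chi>_pos[OF x0y0(2)] by simp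
  ultimately show False by simp
qed

text \<open>\<open>P_has_derivative_y\<close> stops short of \<open>x = L\<close>. The full moment
  is therefore split at \<open>0\<close> into \<open>P 0\<close> and the \<open>P 0\<close> of the
  reflected solution; the boundary terms disappear because \<open>\<phi>' 0 = 0\<close> and the two
  \<open>vx\<close> terms are opposite.\<close>

lemma moment_solves_ode:
  assumes y: "\<bar>y\<bar> < M"
  shows "((\<lambda>y. P L y) has_real_derivative deriv (\<lambda>y. P L y) y) (at y)"
    and "(deriv (\<lambda>y. P L y) has_real_derivative (y\<^sup>2 / 4 - (\<Lambda> - even_level L)) * P L y) (at y)"
proof -
  interpret refl: rect_sol L M \<Lambda> "\<lambda>x y. v (-x) y" "\<lambda>x y. - vx (-x) y" "\<lambda>x y. vxx (-x) y"
     "\<lambda>x y. vy (-x) y" "\<lambda>x y. vyy (-x) y"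
    by (rule rect_sol_reflect)
  have split: "P L y = P 0 y + refl.P 0 y" if "\<bar>y\<bar> \<le> M" for y
  proof -
    have c: "continuous_on {-L..L} (\<lambda>t. v t y * \<phi> t)"
      by (intro continuous_intros cont_slice_x even_sol_cont that)
    have "P L y = integral {-L..0} (\<lambda>t. v t y * \<phi> t) + integral {0..L} (\<lambda>t. v t y * \<phi> t)"
      unfolding P_def using L c
      by (intro Henstock_Kurzweil_Integration.integral_combine[symmetric] integrable_continuous_interval) auto
    also have "integral {0..L} (\<lambda>t. v t y * \<phi> t) = refl.P 0 y"
      using Henstock_Kurzweil_Integration.integral_reflect_real[of L 0 "\<lambda>t. v t y * \<phi> t"] by (simp add: refl.P_def)
    finally show ?thesis by (simp add: P_def)
  qed
  have D: "((\<lambda>y. P L y) has_real_derivative deriv (P 0) y + deriv (refl.P 0) y) (at y)" if "\<bar>y\<bar> < M" for y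
  proof -
    have "((\<lambda>y. P 0 y + refl.P 0 y) has_real_derivative deriv (P 0) y + deriv (refl.P 0) y) (at y)"
      using L that by (intro DERIV_add P_has_derivative_y refl.P_has_derivative_y) auto
    then show ?thesis
      by (rule has_field_derivative_transform_within_open[where S = "{-M<..<M}"]) (use that split in auto)
  qed
  have deriv: "deriv (\<lambda>y. P L y) y = deriv (P 0) y + deriv (refl.P 0) y" if "\<bar>y\<bar> < M" for y
    by (rule DERIV_imp_deriv[OF D[OF that]])
  show "((\<lambda>y. P L y) has_real_derivative deriv (\<lambda>y. P L y) y) (at y)"
    using D[OF y] deriv[OF y] by simp
  have "((\<lambda>y. deriv (P 0) y + deriv (refl.P 0) y) has_real_derivative
      (v 0 y * \<phi>' 0 - vx 0 y * \<phi> 0 + (y\<^sup>2 / 4 + even_level L - \<Lambda>) * P 0 y)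
      + (v (-0) y * \<phi>' 0 - (- vx (-0) y) * \<phi> 0 + (y\<^sup>2 / 4 + even_level L - \<Lambda>) * refl.P 0 y)) (at y)"
    by (rule DERIV_add[OF P_has_derivative_y(2) refl.P_has_derivative_y(2)]) (use L y in auto)
  then have "((\<lambda>y. deriv (P 0) y + deriv (refl.P 0) y) has_real_derivative
      (y\<^sup>2 / 4 - (\<Lambda> - even_level L)) * P L y) (at y)"
    by (rule DERIV_cong) (use y in \<open>simp add: split algebra_simps\<close>)
  then show "(deriv (\<lambda>y. P L y) has_real_derivative (y\<^sup>2 / 4 - (\<Lambda> - even_level L)) * P L y) (at y)"
    by (rule has_field_derivative_transform_within_open[where S = "{-M<..<M}"]) (use y deriv in auto)
qed

end

text \<open>The hypothesis \<open>moment\<close> deals with the one energy at which the full moment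
  could be a nonzero multiple of the first solution in \<open>y\<close>. Once the moment vanishes,
  the maximum principle for \<open>v\<close> and \<open>-v\<close> gives \<open>P = 0\<close>;
  differentiating in \<open>x\<close> gives \<open>v * \<phi> = 0\<close>, and \<open>\<phi>\<close>
  is positive inside.\<close>

lemma rect_sol_zero:
  assumes sol: "rect_sol L M \<Lambda> v vx vxx vy vyy"
    and gap: "odd_level L - even_level L \<le> odd_level M - even_level M"
    and \<Lambda>: "\<Lambda> < odd_level L + even_level M"
    and moment: "\<Lambda> = even_level L + even_level M \<Longrightarrow>
      integral {-L..L} (\<lambda>t. v t 0 * even_sol (even_level L) t) = 0"
    and xy: "\<bar>x\<bar> \<le> L" "\<bar>y\<bar> \<le> M"
  shows "v x y = 0"
proof -
  interpret rect_sol L M \<Lambda> v vx vxx vy vyy by fact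
  interpret neg: rect_sol L M \<Lambda> "\<lambda>x y. -1 * v x y + 0 * v x y" "\<lambda>x y. -1 * vx x y + 0 * vx x y"
      "\<lambda>x y. -1 * vxx x y + 0 * vxx x y" "\<lambda>x y. -1 * vy x y + 0 * vy x y" "\<lambda>x y. -1 * vyy x y + 0 * vyy x y"
    by (rule rect_sol_linear[OF sol sol])
  have neg_P: "neg.P x y = - P x y" for x y unfolding P_def neg.P_def by simp
  have c: "continuous_on {-M..M} (\<lambda>y. P L y)"
  proof -
    have "continuous_on {-M..M} (\<lambda>y. (\<lambda>(x, y). P x y) (L, y))"
      by (rule continuous_on_compose2[OF P_cont]) (use L in \<open>auto intro!: continuous_intros\<close>)
    then show ?thesis by simp
  qed
  have "P L y = 0" if "\<bar>y\<bar> = M" for y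
  proof -
    have "P L y = integral {-L..L} (\<lambda>t. 0)"
      unfolding P_def using that zero by (intro integral_cong) auto
    then show ?thesis by simp
  qed
  then have ends: "P L (-M) = 0" "P L M = 0" using M by auto
  \<comment> \<open>By \<open>gap\<close> the energy left for the \<open>y\<close>-direction stays
    below the second level there, as \<open>dirichlet_interval\<close> requires.\<close>
  have E: "\<Lambda> - even_level L < odd_level M" using gap \<Lambda> by simp
  note ode = dirichlet_interval[OF M c moment_solves_ode ends E]
  have "P L 0 = 0"
    using ode(1) moment by (auto simp: P_def)
  then have P0: "P L y = 0" if "\<bar>y\<bar> \<le> M" for y using ode(2)[of y] that \<open>P L 0 = 0\<close> by (auto simp: abs_le_iff)
  have P: "P x y = 0" if "\<bar>x\<bar> \<le> L" "\<bar>y\<bar> \<le> M" for x y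
  proof (rule antisym)
    show "P x y \<le> 0" by (rule P_nonpos[OF \<Lambda> P0 that])
    have "neg.P x y \<le> 0" by (rule neg.P_nonpos[OF \<Lambda> _ that]) (unfold neg_P, simp add: P0)
    then show "0 \<le> P x y" unfolding neg_P by simp
  qed
  show ?thesis
  proof (cases "\<bar>x\<bar> < L")
    case True
    have "((\<lambda>x. 0) has_real_derivative v x y * even_sol (even_level L) x) (at x)"
      by (rule has_field_derivative_transform_within_open[OF P_has_derivative_x[OF True xy(2)], where S = "{-L<..<L}"])
        (use True P xy in auto)
    then have "v x y * even_sol (even_level L) x = 0"
      using DERIV_const DERIV_unique by blast
    then show ?thesis using even_level_sol_pos[OF L True] by simp
  next
    case False
    then show ?thesis using xy zero by simp
  qed
qed

section \<open>Eigenfunctions as solutions on a rectangle\<close>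

lemma Basis_real_prod: "(Basis :: (real \<times> real) set) = {(1, 0), (0, 1)}"
  by (auto simp: Basis_prod_def)

lemma laplacian_real_prod:
  "laplacian f p = partial (1, 0) (partial (1, 0) f) p + partial (0, 1) (partial (0, 1) f) p"
  for f :: "real \<times> real \<Rightarrow> real"
  by (simp add: laplacian_def Basis_real_prod)

lemma partial_has_real_derivative:
  fixes f :: "real \<times> real \<Rightarrow> real"
  assumes "f differentiable (at (x, y))"
  shows "((\<lambda>x. f (x, y)) has_real_derivative partial (1, 0) f (x, y)) (at x)"
    and "((\<lambda>y. f (x, y)) has_real_derivative partial (0, 1) f (x, y)) (at y)"
proof -
  define F where "F = frechet_derivative f (at (x, y))"
  have F: "(f has_derivative F) (at (x, y))"
    unfolding F_def using assms by (simp add: frechet_derivative_works)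
  interpret F: linear F using F by (rule has_derivative_linear)
  have "((\<lambda>x. f (x, y)) has_derivative (\<lambda>h. F (h, 0))) (at x)"
    by (rule has_derivative_compose[where f = "\<lambda>x. (x, y)" and g = f, OF _ F]) (auto intro!: derivative_eq_intros)
  moreover have "F (h, 0) = partial (1, 0) f (x, y) * h" for h
    using F.scale[of h "(1, 0)"] by (simp add: partial_def F_def mult.commute)
  ultimately show "((\<lambda>x. f (x, y)) has_real_derivative partial (1, 0) f (x, y)) (at x)"
    by (simp add: has_field_derivative_def)
  have "((\<lambda>y. f (x, y)) has_derivative (\<lambda>h. F (0, h))) (at y)"
    by (rule has_derivative_compose[where f = "\<lambda>y. (x, y)" and g = f, OF _ F]) (auto intro!: derivative_eq_intros)
  moreover have "F (0, h) = partial (0, 1) f (x, y) * h" for h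
    using F.scale[of h "(0, 1)"] by (simp add: partial_def F_def mult.commute)
  ultimately show "((\<lambda>y. f (x, y)) has_real_derivative partial (0, 1) f (x, y)) (at y)"
    by (simp add: has_field_derivative_def)
qed

lemma thin_rect_topology:
  assumes "0 < D" "0 < \<epsilon>"
  shows "open (thin_rect D \<epsilon>)"
    and "closure (thin_rect D \<epsilon>) = {- (D/2)..D/2} \<times> {-\<epsilon>..\<epsilon>}"
    and "frontier (thin_rect D \<epsilon>) = {- (D/2)..D/2} \<times> {-\<epsilon>..\<epsilon>} - {- (D/2)<..<D/2} \<times> {-\<epsilon><..<\<epsilon>}"
proof -
  show o: "open (thin_rect D \<epsilon>)" unfolding thin_rect_def by (intro open_Times) auto
  show c: "closure (thin_rect D \<epsilon>) = {- (D/2)..D/2} \<times> {-\<epsilon>..\<epsilon>}"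
    unfolding thin_rect_def using assms by (simp add: closure_Times)
  show "frontier (thin_rect D \<epsilon>) = {- (D/2)..D/2} \<times> {-\<epsilon>..\<epsilon>} - {- (D/2)<..<D/2} \<times> {-\<epsilon><..<\<epsilon>}"
    unfolding frontier_def c interior_open[OF o] by (simp add: thin_rect_def)
qed

lemma eigenspace_rect_sol:
  assumes "0 < D" "0 < \<epsilon>" and v: "v \<in> eigenspace (thin_rect D \<epsilon>) lam"
  shows "rect_sol (D/2) \<epsilon> (lam + 1) (\<lambda>x y. v (x, y)) (\<lambda>x y. partial (1, 0) v (x, y))
    (\<lambda>x y. partial (1, 0) (partial (1, 0) v) (x, y)) (\<lambda>x y. partial (0, 1) v (x, y))
    (\<lambda>x y. partial (0, 1) (partial (0, 1) v) (x, y))"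
proof -
  note top = thin_rect_topology[OF assms(1,2)]
  have \<Omega>: "thin_rect D \<epsilon> = {- (D/2)<..<D/2} \<times> {-\<epsilon><..<\<epsilon>}" by (simp add: thin_rect_def)
  have mem: "(x, y) \<in> thin_rect D \<epsilon>" if "\<bar>x\<bar> < D/2" "\<bar>y\<bar> < \<epsilon>" for x y
    using that by (auto simp: \<Omega> abs_less_iff)
  have C2: "v differentiable_on thin_rect D \<epsilon>"
      "\<And>b. b \<in> Basis \<Longrightarrow> partial b v differentiable_on thin_rect D \<epsilon>"
      "\<And>b c. b \<in> Basis \<Longrightarrow> c \<in> Basis \<Longrightarrow> continuous_on (thin_rect D \<epsilon>) (partial c (partial b v))"
    and cont: "continuous_on (closure (thin_rect D \<epsilon>)) v"
    and eq: "\<And>p. p \<in> thin_rect D \<epsilon> \<Longrightarrow> - laplacian v p + 1 / 4 * (norm p)\<^sup>2 * v p = (lam + 1) * v p"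
    and bd: "\<And>p. p \<in> frontier (thin_rect D \<epsilon>) \<Longrightarrow> v p = 0"
    using v unfolding eigenspace_def C2_on_def by auto
  have at: "f differentiable (at (x, y))" if "f differentiable_on thin_rect D \<epsilon>" "\<bar>x\<bar> < D/2" "\<bar>y\<bar> < \<epsilon>"
    for f :: "real \<times> real \<Rightarrow> real" and x y
    using that(1) mem[OF that(2,3)] top(1) by (simp add: differentiable_on_eq_differentiable_at)
  show ?thesis
  proof
    show "partial (1, 0) (partial (1, 0) v) (x, y) + partial (0, 1) (partial (0, 1) v) (x, y)
      = ((x\<^sup>2 + y\<^sup>2) / 4 - (lam + 1)) * v (x, y)" if "\<bar>x\<bar> < D/2" "\<bar>y\<bar> < \<epsilon>" for x y
      using eq[OF mem[OF that]] by (simp add: laplacian_real_prod norm_Pair algebra_simps)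
    show "v (x, y) = 0" if "\<bar>x\<bar> \<le> D/2" "\<bar>y\<bar> \<le> \<epsilon>" "\<bar>x\<bar> = D/2 \<or> \<bar>y\<bar> = \<epsilon>" for x y
      using that by (intro bd) (auto simp: top(3) abs_if split: if_splits)
    show "((\<lambda>x. v (x, y)) has_real_derivative partial (1, 0) v (x, y)) (at x)"
      "((\<lambda>y. v (x, y)) has_real_derivative partial (0, 1) v (x, y)) (at y)"
      if "\<bar>x\<bar> < D/2" "\<bar>y\<bar> < \<epsilon>" for x y
      by (rule partial_has_real_derivative[OF at[OF C2(1) that]])+
    show "((\<lambda>x. partial (1, 0) v (x, y)) has_real_derivative partial (1, 0) (partial (1, 0) v) (x, y)) (at x)"
      "((\<lambda>y. partial (0, 1) v (x, y)) has_real_derivative partial (0, 1) (partial (0, 1) v) (x, y)) (at y)"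
      if "\<bar>x\<bar> < D/2" "\<bar>y\<bar> < \<epsilon>" for x y
      using partial_has_real_derivative(1)[OF at[OF C2(2)[of "(1, 0)"] that]]
        partial_has_real_derivative(2)[OF at[OF C2(2)[of "(0, 1)"] that]]
      by (simp_all add: Basis_real_prod)
  qed (use assms(1,2) cont C2 in \<open>simp_all add: top \<Omega>[symmetric] case_prod_beta Basis_real_prod differentiable_imp_continuous_on\<close>)
qed

text \<open>Agreement with the product is asked only on \<open>S\<close>, so that the lemma covers
  functions cut off outside and can be applied again to the partial derivatives.\<close>

lemma separable_partial:
  fixes g :: "real \<times> real \<Rightarrow> real"
  assumes "open S" and g: "\<And>p. p \<in> S \<Longrightarrow> g p = f (fst p) * h (snd p)"
    and f: "\<And>x. (f has_real_derivative f' x) (at x)" and h: "\<And>y. (h has_real_derivative h' y) (at y)"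
  shows "g differentiable_on S"
    and "p \<in> S \<Longrightarrow> partial (1, 0) g p = f' (fst p) * h (snd p)"
    and "p \<in> S \<Longrightarrow> partial (0, 1) g p = f (fst p) * h' (snd p)"
proof -
  have D: "(g has_derivative (\<lambda>q. f (fst p) * (h' (snd p) * snd q) + f' (fst p) * fst q * h (snd p))) (at p)"
    if "p \<in> S" for p
  proof -
    have "((\<lambda>p. f (fst p)) has_derivative (\<lambda>q. f' (fst p) * fst q)) (at p)"
      by (rule has_derivative_compose[where g = f and f = fst, OF has_derivative_fst[OF has_derivative_ident]])
        (use f in \<open>simp add: has_field_derivative_def\<close>)
    moreover have "((\<lambda>p. h (snd p)) has_derivative (\<lambda>q. h' (snd p) * snd q)) (at p)"
      by (rule has_derivative_compose[where g = h and f = snd, OF has_derivative_snd[OF has_derivative_ident]])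
        (use h in \<open>simp add: has_field_derivative_def\<close>)
    ultimately have "((\<lambda>p. f (fst p) * h (snd p)) has_derivative
        (\<lambda>q. f (fst p) * (h' (snd p) * snd q) + f' (fst p) * fst q * h (snd p))) (at p)"
      by (rule has_derivative_mult)
    then show ?thesis
      by (rule has_derivative_transform_within_open[OF _ \<open>open S\<close> that]) (simp add: g)
  qed
  show "g differentiable_on S"
    unfolding differentiable_on_eq_differentiable_at[OF \<open>open S\<close>] differentiable_def using D by blast
  show "partial (1, 0) g p = f' (fst p) * h (snd p)" "partial (0, 1) g p = f (fst p) * h' (snd p)" if "p \<in> S"
    unfolding partial_def frechet_derivative_at[OF D[OF that], symmetric] by simp_all
qed

text \<open>Cut off outside the closure, as membership in \<open>eigenspace\<close> demands.\<close>

definition product_sol :: "real \<Rightarrow> real \<Rightarrow> (real \<Rightarrow> real) \<Rightarrow> (real \<Rightarrow> real) \<Rightarrow> real \<times> real \<Rightarrow> real" where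
  "product_sol D \<epsilon> f h p = (if p \<in> closure (thin_rect D \<epsilon>) then f (fst p) * h (snd p) else 0)"

lemma product_sol_eigenspace:
  assumes "0 < D" "0 < \<epsilon>"
    and f: "\<And>x. (f has_real_derivative f' x) (at x)"
      "\<And>x. (f' has_real_derivative (x\<^sup>2 / 4 - E) * f x) (at x)"
    and h: "\<And>y. (h has_real_derivative h' y) (at y)"
      "\<And>y. (h' has_real_derivative (y\<^sup>2 / 4 - F) * h y) (at y)"
    and zero: "f (- (D/2)) = 0" "f (D/2) = 0" "h (- \<epsilon>) = 0" "h \<epsilon> = 0"
  shows "product_sol D \<epsilon> f h \<in> eigenspace (thin_rect D \<epsilon>) (E + F - 1)"
proof -
  let ?S = "thin_rect D \<epsilon>" and ?v = "product_sol D \<epsilon> f h"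
  note top = thin_rect_topology[OF assms(1,2)]
  have v: "?v p = f (fst p) * h (snd p)" if "p \<in> ?S" for p
    using that closure_subset[of ?S] by (auto simp: product_sol_def)
  note p1 = separable_partial[OF top(1) v f(1) h(1)]
  note px = separable_partial[OF top(1) p1(2) f(2) h(1)]
  note py = separable_partial[OF top(1) p1(3) f(1) h(2)]
  have cf: "continuous_on A f" "continuous_on A f'" "continuous_on A h" "continuous_on A h'" for A
    by (rule DERIV_continuous_on, rule DERIV_subset, rule f h, rule subset_UNIV)+
  have c: "continuous_on A (\<lambda>p. f (fst p))" "continuous_on A (\<lambda>p. f' (fst p))"
    "continuous_on A (\<lambda>p. h (snd p))" "continuous_on A (\<lambda>p. h' (snd p))" for A :: "(real \<times> real) set"
    by (rule continuous_on_compose2[OF cf(1)[of UNIV]], intro continuous_intros, simp)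
      (rule continuous_on_compose2[OF cf(2)[of UNIV]], intro continuous_intros, simp,
       rule continuous_on_compose2[OF cf(3)[of UNIV]], intro continuous_intros, simp,
       rule continuous_on_compose2[OF cf(4)[of UNIV]], intro continuous_intros, simp)
  have "C2_on ?S ?v"
    unfolding C2_on_def Basis_real_prod
  proof (intro conjI ballI)
    show "partial b ?v differentiable_on ?S" if "b \<in> {(1, 0), (0, 1)}" for b
      using that px(1) py(1) by auto
    have "continuous_on ?S (partial (1, 0) (partial (1, 0) ?v))"
      by (rule continuous_on_eq[where f = "\<lambda>p. ((fst p)\<^sup>2 / 4 - E) * f (fst p) * h (snd p)"])
        (auto intro!: continuous_intros c simp: px)
    moreover have "continuous_on ?S (partial (0, 1) (partial (1, 0) ?v))"
      by (rule continuous_on_eq[where f = "\<lambda>p. f' (fst p) * h' (snd p)"])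
        (auto intro!: continuous_intros c simp: px)
    moreover have "continuous_on ?S (partial (1, 0) (partial (0, 1) ?v))"
      by (rule continuous_on_eq[where f = "\<lambda>p. f' (fst p) * h' (snd p)"])
        (auto intro!: continuous_intros c simp: py)
    moreover have "continuous_on ?S (partial (0, 1) (partial (0, 1) ?v))"
      by (rule continuous_on_eq[where f = "\<lambda>p. f (fst p) * (((snd p)\<^sup>2 / 4 - F) * h (snd p))"])
        (auto intro!: continuous_intros c simp: py)
    ultimately show "continuous_on ?S (partial c (partial b ?v))"
      if "b \<in> {(1, 0), (0, 1)}" "c \<in> {(1, 0), (0, 1)}" for b c
      using that by auto
  qed (rule p1)
  moreover have "continuous_on (closure ?S) ?v"
    by (rule continuous_on_eq[where f = "\<lambda>p. f (fst p) * h (snd p)"])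
      (auto intro!: continuous_intros c simp: product_sol_def)
  moreover have "- laplacian ?v p + 1 / 4 * (norm p)\<^sup>2 * ?v p = (E + F - 1 + 1) * ?v p" if "p \<in> ?S" for p
    using that by (cases p) (simp add: laplacian_real_prod px py v norm_Pair field_simps)
  moreover have "?v p = 0" if "p \<in> frontier ?S" for p
  proof -
    have "fst p = - (D/2) \<or> fst p = D/2 \<or> snd p = - \<epsilon> \<or> snd p = \<epsilon>"
      using that by (cases p) (auto simp: top)
    then show ?thesis using zero by (auto simp: product_sol_def)
  qed
  ultimately show ?thesis by (auto simp: eigenspace_def product_sol_def)
qed

section \<open>Multiplicities and eigenvalues\<close>

lemma eig_multiplicity_eq_0:
  assumes "eigenspace \<Omega> lam \<subseteq> {0}"
  shows "eig_multiplicity \<Omega> lam = 0"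
proof -
  have "enat (card B) \<le> 0" if "B \<subseteq> eigenspace \<Omega> lam" "fun_vs.independent B" for B
  proof -
    have "0 \<notin> B" using that(2) fun_vs.dependent_zero by blast
    then have "B = {}" using that(1) assms by blast
    then show ?thesis by (simp add: zero_enat_def)
  qed
  then have "eig_multiplicity \<Omega> lam \<le> 0"
    unfolding eig_multiplicity_def by (intro SUP_least) blast
  then show ?thesis by simp
qed

lemma eig_multiplicity_ge_1:
  assumes "v \<in> eigenspace \<Omega> lam" "v \<noteq> 0"
  shows "1 \<le> eig_multiplicity \<Omega> lam"
proof -
  have "enat (card {v}) \<le> eig_multiplicity \<Omega> lam"
    unfolding eig_multiplicity_def
    by (rule SUP_upper) (use assms in \<open>auto simp: fun_vs.dependent_single\<close>)
  then show ?thesis by (simp add: one_enat_def)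
qed

text \<open>Two distinct elements of an independent set would be linearly related by the hypothesis,
  so such a set has at most one element.\<close>

lemma eig_multiplicity_le_1:
  assumes "\<And>v w. v \<in> eigenspace \<Omega> lam \<Longrightarrow> w \<in> eigenspace \<Omega> lam \<Longrightarrow>
    \<exists>a b. (a \<noteq> 0 \<or> b \<noteq> 0) \<and> (\<forall>p. a * v p + b * w p = 0)"
  shows "eig_multiplicity \<Omega> lam \<le> 1"
  unfolding eig_multiplicity_def
proof (rule SUP_least)
  fix B assume "B \<in> {B. finite B \<and> B \<subseteq> eigenspace \<Omega> lam \<and> fun_vs.independent B}"
  then have B: "finite B" "B \<subseteq> eigenspace \<Omega> lam" "fun_vs.independent B" by auto
  have in_span: "v \<in> fun_vs.span (B - {v})"
    if "w \<in> B" "v \<noteq> w" "a \<noteq> 0" "\<forall>p. a * v p + b * w p = 0" for v w a b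
  proof -
    have "v = (\<lambda>p. (- b / a) * w p)"
    proof
      fix p
      have "a * v p = - b * w p" using that(4)[rule_format, of p] by simp
      then show "v p = (- b / a) * w p" using \<open>a \<noteq> 0\<close> by (simp add: field_simps)
    qed
    moreover have "(\<lambda>p. (- b / a) * w p) \<in> fun_vs.span (B - {v})"
      by (rule fun_vs.span_scale, rule fun_vs.span_base) (use that in auto)
    ultimately show ?thesis by simp
  qed
  have "v = w" if vw: "v \<in> B" "w \<in> B" for v w
  proof (rule ccontr)
    assume "v \<noteq> w"
    obtain a b where ab: "a \<noteq> 0 \<or> b \<noteq> 0" "\<forall>p. a * v p + b * w p = 0"
      using assms[of v w] vw B(2) by blast
    then have "v \<in> fun_vs.span (B - {v}) \<or> w \<in> fun_vs.span (B - {w})"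
      using in_span[of w v a b] in_span[of v w b a] vw \<open>v \<noteq> w\<close> by (auto simp: add.commute)
    then show False using B(3) vw unfolding fun_vs.dependent_def by blast
  qed
  then have "card B \<le> 1" using B(1) by (auto simp: card_le_Suc0_iff_eq)
  then show "enat (card B) \<le> 1" by (simp add: one_enat_def)
qed

text \<open>Products of one-dimensional solutions are eigenfunctions at \<open>m1\<close> and
  \<open>m2\<close>. Below \<open>m2\<close>, \<open>rect_sol_zero\<close> leaves only
  \<open>m1\<close>, and with multiplicity at most one: on that eigenspace the moment at
  \<open>y = 0\<close> is a linear functional with trivial kernel.\<close>

lemma eigval_eq_levels:
  assumes D: "0 < D" and \<epsilon>: "0 < \<epsilon>"
    and gap: "odd_level (D/2) - even_level (D/2) \<le> odd_level \<epsilon> - even_level \<epsilon>"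
  shows "eigval (thin_rect D \<epsilon>) 1 = even_level (D/2) + even_level \<epsilon> - 1"
    and "eigval (thin_rect D \<epsilon>) 2 = odd_level (D/2) + even_level \<epsilon> - 1"
proof -
  define L where "L = D/2"
  have L: "0 < L" using D by (simp add: L_def)
  let ?\<Omega> = "thin_rect D \<epsilon>"
  note top = thin_rect_topology[OF D \<epsilon>]
  define m1 where "m1 = even_level L + even_level \<epsilon> - 1"
  define m2 where "m2 = odd_level L + even_level \<epsilon> - 1"
  have m12: "m1 < m2" using even_level_less_odd_level[OF L] by (simp add: m1_def m2_def)
  define moment where "moment v = integral {-L..L} (\<lambda>t. v (t, 0) * even_sol (even_level L) t)"
    for v :: "real \<times> real \<Rightarrow> real"
  note sol = eigenspace_rect_sol[OF D \<epsilon>, folded L_def]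
  have comb_zero: "a * v p + b * w p = 0"
    if vw: "v \<in> eigenspace ?\<Omega> lam" "w \<in> eigenspace ?\<Omega> lam" and "lam < m2"
      and mom: "lam = m1 \<Longrightarrow> a * moment v + b * moment w = 0" for v w lam a b p
  proof (cases "p \<in> closure ?\<Omega>")
    case True
    obtain x y where p: "p = (x, y)" by fastforce
    interpret v: rect_sol L \<epsilon> "lam + 1" "\<lambda>x y. v (x, y)" "\<lambda>x y. partial (1, 0) v (x, y)"
      "\<lambda>x y. partial (1, 0) (partial (1, 0) v) (x, y)" "\<lambda>x y. partial (0, 1) v (x, y)"
      "\<lambda>x y. partial (0, 1) (partial (0, 1) v) (x, y)"
      by (rule sol[OF vw(1)])
    interpret w: rect_sol L \<epsilon> "lam + 1" "\<lambda>x y. w (x, y)" "\<lambda>x y. partial (1, 0) w (x, y)"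
      "\<lambda>x y. partial (1, 0) (partial (1, 0) w) (x, y)" "\<lambda>x y. partial (0, 1) w (x, y)"
      "\<lambda>x y. partial (0, 1) (partial (0, 1) w) (x, y)"
      by (rule sol[OF vw(2)])
    have "a * v (x, y) + b * w (x, y) = 0"
    proof (rule rect_sol_zero[OF rect_sol_linear[OF sol[OF vw(1)] sol[OF vw(2)]]])
      show "odd_level L - even_level L \<le> odd_level \<epsilon> - even_level \<epsilon>" using gap by (simp add: L_def)
      show "lam + 1 < odd_level L + even_level \<epsilon>" using \<open>lam < m2\<close> by (simp add: m2_def)
      show "\<bar>x\<bar> \<le> L" "\<bar>y\<bar> \<le> \<epsilon>" using True by (auto simp: p top(2) L_def)
      assume "lam + 1 = even_level L + even_level \<epsilon>"
      then have "a * moment v + b * moment w = 0" by (intro mom) (simp add: m1_def)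
      moreover have "integral {-L..L} (\<lambda>t. a * (v (t, 0) * even_sol (even_level L) t) + b * (w (t, 0) * even_sol (even_level L) t))
          = integral {-L..L} (\<lambda>t. a * (v (t, 0) * even_sol (even_level L) t))
          + integral {-L..L} (\<lambda>t. b * (w (t, 0) * even_sol (even_level L) t))"
        using \<epsilon> by (intro integral_add integrable_continuous_interval continuous_intros
            v.cont_slice_x w.cont_slice_x even_sol_cont) auto
      ultimately show "integral {-L..L} (\<lambda>t. (a * v (t, 0) + b * w (t, 0)) * even_sol (even_level L) t) = 0"
        by (simp add: moment_def algebra_simps)
    qed
    then show ?thesis by (simp add: p)
  next
    case False
    have "u p = 0" if "u \<in> eigenspace ?\<Omega> lam" for u
      using that False unfolding eigenspace_def mem_Collect_eq by (elim conjE, elim allE[of _ p] impE) assumption+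
    then have "v p = 0" "w p = 0" using vw by simp_all
    then show ?thesis by simp
  qed
  have mult_0: "eig_multiplicity ?\<Omega> lam = 0" if "lam < m2" "lam \<noteq> m1" for lam
  proof (rule eig_multiplicity_eq_0, rule subsetI)
    fix v assume "v \<in> eigenspace ?\<Omega> lam"
    then have "v p = 0" for p using comb_zero[of v lam v 1 0 p] that by simp
    then show "v \<in> {0}" by auto
  qed
  have mult_le: "eig_multiplicity ?\<Omega> m1 \<le> 1"
  proof (rule eig_multiplicity_le_1)
    fix v w assume vw: "v \<in> eigenspace ?\<Omega> m1" "w \<in> eigenspace ?\<Omega> m1"
    show "\<exists>a b. (a \<noteq> 0 \<or> b \<noteq> 0) \<and> (\<forall>p. a * v p + b * w p = 0)"
    proof (cases "moment v = 0")
      case True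
      then have "\<forall>p. 1 * v p + 0 * w p = 0" using comb_zero[OF vw m12, of 1 0] by simp
      then show ?thesis by (intro exI[of _ 1] exI[of _ 0]) simp
    next
      case False
      \<comment> \<open>The moments cancel in this combination, so it is zero.\<close>
      have "\<forall>p. moment w * v p + (- moment v) * w p = 0"
        using comb_zero[OF vw m12, of "moment w" "- moment v"] by simp
      then show ?thesis using False by (intro exI[of _ "moment w"] exI[of _ "- moment v"]) simp
    qed
  qed
  have nonzero: "product_sol D \<epsilon> f h \<noteq> 0" if "\<bar>x\<bar> \<le> L" "f x * h 0 \<noteq> 0" for f h x
  proof -
    have "product_sol D \<epsilon> f h (x, 0) \<noteq> 0"
      using that \<epsilon> by (auto simp: product_sol_def top(2) L_def abs_le_iff)
    then show ?thesis by auto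
  qed
  have mult_ge_m1: "1 \<le> eig_multiplicity ?\<Omega> m1"
  proof (rule eig_multiplicity_ge_1)
    show "product_sol D \<epsilon> (even_sol (even_level L)) (even_sol (even_level \<epsilon>)) \<in> eigenspace ?\<Omega> m1"
      unfolding m1_def by (rule product_sol_eigenspace[OF D \<epsilon> even_sol_DERIV even_sol_DERIV])
        (use L \<epsilon> in \<open>simp_all add: L_def\<close>)
    show "product_sol D \<epsilon> (even_sol (even_level L)) (even_sol (even_level \<epsilon>)) \<noteq> 0"
      by (rule nonzero[of 0]) (use L in simp_all)
  qed
  have mult_ge_m2: "1 \<le> eig_multiplicity ?\<Omega> m2"
  proof (rule eig_multiplicity_ge_1)
    show "product_sol D \<epsilon> (odd_sol (odd_level L)) (even_sol (even_level \<epsilon>)) \<in> eigenspace ?\<Omega> m2"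
      unfolding m2_def by (rule product_sol_eigenspace[OF D \<epsilon> odd_sol_DERIV even_sol_DERIV])
        (use L \<epsilon> in \<open>simp_all add: L_def\<close>)
    show "product_sol D \<epsilon> (odd_sol (odd_level L)) (even_sol (even_level \<epsilon>)) \<noteq> 0"
      \<comment> \<open>The odd solution vanishes at \<open>0\<close>, so the nonzero value is taken
        at \<open>x = L/2\<close>.\<close>
      by (rule nonzero[of "L/2"]) (use L odd_level_sol_pos[OF L, of "L/2"] in simp_all)
  qed
  have total: "(\<Sum>lam\<in>F. eig_multiplicity ?\<Omega> lam) \<le> (if m1 \<in> F then 1 else 0)"
    if "finite F" "F \<subseteq> {..\<mu>}" "\<mu> < m2" for F \<mu>
  proof -
    have "(\<Sum>lam\<in>F. eig_multiplicity ?\<Omega> lam) = (\<Sum>lam\<in>F. if lam = m1 then eig_multiplicity ?\<Omega> lam else 0)"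
      using that mult_0 by (intro sum.cong) force+
    also have "\<dots> = (if m1 \<in> F then eig_multiplicity ?\<Omega> m1 else 0)"
      using that(1) by (simp add: sum.delta)
    also have "\<dots> \<le> (if m1 \<in> F then 1 else 0)" using mult_le by simp
    finally show ?thesis .
  qed
  show "eigval ?\<Omega> 1 = even_level (D/2) + even_level \<epsilon> - 1"
    unfolding eigval_def L_def[symmetric] m1_def[symmetric]
  proof (rule Least_equality)
    show "\<exists>F. finite F \<and> F \<subseteq> {..m1} \<and> enat 1 \<le> (\<Sum>lam\<in>F. eig_multiplicity ?\<Omega> lam)"
      using mult_ge_m1 by (intro exI[of _ "{m1}"]) (simp add: one_enat_def)
  next
    fix \<mu> assume "\<exists>F. finite F \<and> F \<subseteq> {..\<mu>} \<and> enat 1 \<le> (\<Sum>lam\<in>F. eig_multiplicity ?\<Omega> lam)"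
    then obtain F where F: "finite F" "F \<subseteq> {..\<mu>}" "enat 1 \<le> (\<Sum>lam\<in>F. eig_multiplicity ?\<Omega> lam)" by blast
    show "m1 \<le> \<mu>"
    proof (rule ccontr)
      assume less: "\<not> m1 \<le> \<mu>"
      then have "m1 \<notin> F" "\<mu> < m2" using F(2) m12 by auto
      then have "enat 1 \<le> 0" using order_trans[OF F(3) total[OF F(1,2)]] by simp
      then show False by (simp add: zero_enat_def)
    qed
  qed
  show "eigval ?\<Omega> 2 = odd_level (D/2) + even_level \<epsilon> - 1"
    unfolding eigval_def L_def[symmetric] m2_def[symmetric]
  proof (rule Least_equality)
    have "enat 2 = 1 + 1" by (simp add: one_enat_def)
    also have "\<dots> \<le> eig_multiplicity ?\<Omega> m1 + eig_multiplicity ?\<Omega> m2"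
      by (intro add_mono mult_ge_m1 mult_ge_m2)
    finally show "\<exists>F. finite F \<and> F \<subseteq> {..m2} \<and> enat 2 \<le> (\<Sum>lam\<in>F. eig_multiplicity ?\<Omega> lam)"
      using m12 by (intro exI[of _ "{m1, m2}"]) simp
  next
    fix \<mu> assume "\<exists>F. finite F \<and> F \<subseteq> {..\<mu>} \<and> enat 2 \<le> (\<Sum>lam\<in>F. eig_multiplicity ?\<Omega> lam)"
    then obtain F where F: "finite F" "F \<subseteq> {..\<mu>}" "enat 2 \<le> (\<Sum>lam\<in>F. eig_multiplicity ?\<Omega> lam)" by blast
    show "m2 \<le> \<mu>"
    proof (rule ccontr)
      assume "\<not> m2 \<le> \<mu>"
      then have "enat 2 \<le> (if m1 \<in> F then 1 else 0)"
        using order_trans[OF F(3) total[OF F(1,2)]] by simp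
      then show False by (simp add: one_enat_def zero_enat_def split: if_splits)
    qed
  qed
qed

section \<open>Growth of the transversal gap and the limit\<close>

text \<open>The odd level is at least \<open>(pi / \<epsilon>)\<^sup>2\<close> and the even one at
  most a quarter of that plus \<open>\<epsilon>\<^sup>2 / 4\<close>, so the gap grows like
  \<open>1 / \<epsilon>\<^sup>2\<close>.\<close>

lemma eventually_level_gap: "\<forall>\<^sub>F \<epsilon> in at_right 0. G \<le> odd_level \<epsilon> - even_level \<epsilon>"
proof -
  \<comment> \<open>This threshold gives
    \<open>pi / \<epsilon> \<ge> 3 * (\<bar>G\<bar> + 1)\<close> and also
    \<open>\<epsilon> < 1\<close>, which keeps the potential term below \<open>1/4\<close>.\<close>
  have "\<forall>\<^sub>F \<epsilon> in at_right (0::real). \<epsilon> < 1 / (\<bar>G\<bar> + 1)"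
    by (rule eventually_at_rightI[of 0 "1 / (\<bar>G\<bar> + 1)"]) auto
  moreover have "\<forall>\<^sub>F \<epsilon> in at_right (0::real). 0 < \<epsilon>" by (rule eventually_at_right_less)
  ultimately show ?thesis
  proof eventually_elim
    case (elim \<epsilon>)
    have "1 / (\<bar>G\<bar> + 1) \<le> 1" by simp
    then have "\<epsilon> < 1" using elim(1) by linarith
    have "\<bar>G\<bar> + 1 \<le> 1 / \<epsilon>" using elim by (simp add: field_simps)
    also have "\<dots> \<le> (pi / \<epsilon>) / 3" using elim(2) pi_gt3 by (simp add: field_simps)
    finally have "3 * (\<bar>G\<bar> + 1) \<le> pi / \<epsilon>" by simp
    then have "(3 * (\<bar>G\<bar> + 1))\<^sup>2 \<le> (pi / \<epsilon>)\<^sup>2" by (intro power_mono) auto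
    moreover have "(3 * (\<bar>G\<bar> + 1))\<^sup>2 = 9 * (\<bar>G\<bar> * \<bar>G\<bar>) + 18 * \<bar>G\<bar> + 9"
      by (simp add: power2_eq_square algebra_simps)
    moreover have "0 \<le> \<bar>G\<bar> * \<bar>G\<bar>" by simp
    moreover have "(pi / (2 * \<epsilon>))\<^sup>2 = (pi / \<epsilon>)\<^sup>2 / 4" by (simp add: power_divide power_mult_distrib)
    moreover have "\<epsilon>\<^sup>2 \<le> 1" using elim(2) \<open>\<epsilon> < 1\<close> by (simp add: power_le_one)
    moreover have "G \<le> \<bar>G\<bar>" by simp
    ultimately show ?case
      using even_level_le[OF elim(2)] odd_level_ge[OF elim(2)] by linarith
  qed
qed

theorem theorem13:
  fixes D :: real
  assumes "D > 0"
  shows "((\<lambda>\<epsilon>. eigval (thin_rect D \<epsilon>) 2 - eigval (thin_rect D \<epsilon>) 1) \<longlongrightarrow>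
           OU_eigval D 2 - OU_eigval D 1) (at_right 0)"
proof (rule tendsto_eventually)
  have "\<forall>\<^sub>F \<epsilon> in at_right (0::real). 0 < \<epsilon>" by (rule eventually_at_right_less)
  with eventually_level_gap[of "odd_level (D/2) - even_level (D/2)"]
  show "\<forall>\<^sub>F \<epsilon> in at_right 0. eigval (thin_rect D \<epsilon>) 2 - eigval (thin_rect D \<epsilon>) 1
      = OU_eigval D 2 - OU_eigval D 1"
  proof eventually_elim
    \<comment> \<open>In the differences \<open>even_level \<epsilon>\<close> and the shifts by
      \<open>1\<close> and \<open>1/2\<close> cancel, so both sides are
      \<open>odd_level (D/2) - even_level (D/2)\<close>.\<close>
    case (elim \<epsilon>)
    then show ?case
      by (simp only: eigval_eq_levels[OF assms elim(2,1)] OU_eigval_eq_levels[OF assms])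
  qed
qed

end
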